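(* Let $E:0\to Y\stackrel{\imath}{\to}X\stackrel{\pi}{\to}Z\to 0$ be an extension of topological abelian groups. Suppose that $Y$ is a Fréchet topological vector space and $Z$ is a metrizable topological vector space (each regarded as a topological abelian group in $E$). Then $X$ admits a compatible topological vector space structure (i.e. a scalar multiplication $\mathbb{R}\times X\to X$ making $X$, with its given group operation and topology, a topological vector space) in such a way that $E$ becomes an extension of (metrizable) topological vector spaces.
   Context: All topological groups are Hausdorff and abelian; all topological vector spaces are Hausdorff and over $\mathbb{R}$. A topological vector space is Fréchet if it is metrizable, complete and locally convex. An extension of topological abelian groups is a short exact sequence $0\to Y\stackrel{\imath}{\to}X\stackrel{\pi}{\to}Z\to 0$ of topological abelian groups in which $\imath,\pi$ are continuous homomorphisms that are open onto their images. It is an extension of topological vector spaces if moreover $Y,X,Z$ are topological vector spaces and $\imath,\pi$ are linear. *)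

theory Defs
  imports "HOL-Analysis.Analysis"
begin

locale topological_vector_space = vector_space scale
  for scale :: "real \<Rightarrow> 'a::{topological_ab_group_add, t2_space} \<Rightarrow> 'a" +
  assumes continuous_scale: "continuous_on UNIV (\<lambda>(r, x). scale r x)"

text \<open>
  The library only provides \<^const>\<open>complete\<close> for types that carry a uniformity as a class
  parameter.  Completeness of a topological group refers to the uniformity induced by the group
  structure; the following unfolds the library notion of completeness of the whole space for it.
\<close>

definition group_uniformity :: "('a::topological_ab_group_add \<times> 'a) filter"
  where "group_uniformity = filtercomap (\<lambda>(x, y). y - x) (nhds 0)"

definition complete_group :: "'a::topological_ab_group_add itself \<Rightarrow> bool"
  where "complete_group _ \<longleftrightarrow>
    (\<forall>F :: 'a filter. F \<noteq> bot \<longrightarrow> F \<times>\<^sub>F F \<le> group_uniformity \<longrightarrow> (\<exists>x. F \<le> nhds x))"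

definition frechet_space :: "'a::{real_vector, topological_ab_group_add, t2_space} itself \<Rightarrow> bool"
  where "frechet_space _ \<longleftrightarrow>
    topological_vector_space ((*\<^sub>R) :: real \<Rightarrow> 'a \<Rightarrow> 'a) \<and>
    metrizable_space (euclidean :: 'a topology) \<and>
    complete_group TYPE('a) \<and>
    neighbourhood_base_of convex (euclidean :: 'a topology)"

locale group_extension =
  fixes i :: "'y::{topological_ab_group_add, t2_space} \<Rightarrow> 'x::{topological_ab_group_add, t2_space}"
    and p :: "'x \<Rightarrow> 'z::{topological_ab_group_add, t2_space}"
  assumes additive_i: "Modules.additive i"
    and additive_p: "Modules.additive p"
    and continuous_i: "continuous_on UNIV i"
    and continuous_p: "continuous_on UNIV p"
    and open_map_i: "open_map euclidean (top_of_set (range i)) i"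
    and open_map_p: "open_map euclidean (top_of_set (range p)) p"
    and inj_i: "inj i"
    and exact: "range i = {x. p x = 0}"
    and surj_p: "surj p"

locale tvs_extension =
  Y: topological_vector_space sY +
  X: topological_vector_space sX +
  Z: topological_vector_space sZ +
  group_extension i p
  for sY :: "real \<Rightarrow> 'y::{topological_ab_group_add, t2_space} \<Rightarrow> 'y"
    and sX :: "real \<Rightarrow> 'x::{topological_ab_group_add, t2_space} \<Rightarrow> 'x"
    and sZ :: "real \<Rightarrow> 'z::{topological_ab_group_add, t2_space} \<Rightarrow> 'z"
    and i :: "'y \<Rightarrow> 'x"
    and p :: "'x \<Rightarrow> 'z" +
  assumes linear_i: "Vector_Spaces.linear sY sX i"
    and linear_p: "Vector_Spaces.linear sX sZ p"

end

theory Submission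
  imports Defs
begin

text \<open>
Write the extension as \<open>Y \<rightarrow> X \<rightarrow> Z\<close>. As an extension of one torsion-free divisible group by
another, \<open>X\<close> is torsion-free and divisible, so multiplication by rational numbers makes sense in
\<open>X\<close> and is the only possible one. The content of the theorem is that this multiplication is
continuous enough to extend to real scalars.

The estimate that gives this continuity is \<open>fraction_stays_small\<close>: for every neighbourhood \<open>U\<close> of
zero there is another one \<open>U'\<close> such that \<open>x \<in> U'\<close> implies \<open>(k / n) x \<in> U\<close> whenever \<open>0 \<le> k \<le> n\<close>.
Small lifts \<open>c l\<close> of the points \<open>(l / n) p x\<close> form an almost additive function on the cyclic group
of order \<open>n\<close>, with small defects in \<open>Y\<close>. Averaging the defects over the cyclic group yields exactly
\<open>(k / n) x - c k\<close> (\<open>sum_cyclic_defect\<close>). As \<open>Y\<close> is locally convex, the average is as small as the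
defects, whatever \<open>n\<close> is.

For real \<open>t\<close> the product \<open>t x\<close> is the limit of \<open>q x\<close> along the binary truncations \<open>q\<close> of \<open>t\<close>. The
estimate makes this sequence Cauchy. The group \<open>X\<close> may be incomplete, but the sequence converges,
because its image converges to \<open>t p x\<close> in \<open>Z\<close> and the kernel \<open>Y\<close> is complete
(\<open>cauchy_filter_lifts_limit\<close>). Both distributive laws and the compatibility with \<open>Y\<close> and \<open>Z\<close> are
obtained by passing to limits; the associative law follows from the uniqueness of one-parameter
subgroups (\<open>additive_real_eq_0\<close>). The estimate survives the limit (\<open>scale_nhd\<close>) and yields
joint continuity.

Metrizability of \<open>X\<close> concerns the topological groups only. A countable neighbourhood base of zero
in \<open>X\<close> is built from bases in \<open>Y\<close> and \<open>Z\<close> (\<open>metrizable_middle\<close>), and a Hausdorff topological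
abelian group with such a base has an invariant metric by the theorem of Birkhoff and Kakutani
(\<open>halving_base.metrizable\<close>).
\<close>

section \<open>Neighbourhoods of zero in topological abelian groups\<close>

lemma open_translate:
  fixes S :: "'a::topological_ab_group_add set"
  assumes "open S"
  shows "open {u. x + u \<in> S}"
proof -
  have "continuous_on UNIV (\<lambda>u. x + u)" by (intro continuous_intros)
  from continuous_on_open_vimage[THEN iffD1, OF open_UNIV this] assms
  show ?thesis by (auto simp: vimage_def)
qed

lemma symmetric_halving:
  fixes U :: "'a::topological_ab_group_add set"
  assumes "open U" "0 \<in> U"
  obtains V where "open V" "0 \<in> V" "\<And>x. x \<in> V \<Longrightarrow> - x \<in> V" "V \<subseteq> U"
    "\<And>x y. x \<in> V \<Longrightarrow> y \<in> V \<Longrightarrow> x + y \<in> U"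
proof -
  have "((\<lambda>z. fst z + snd z) \<longlongrightarrow> (0::'a)) (nhds 0 \<times>\<^sub>F nhds 0)"
    using tendsto_add_Pair[of "0::'a" 0] by simp
  then have "\<forall>\<^sub>F z in nhds (0::'a) \<times>\<^sub>F nhds 0. fst z + snd z \<in> U"
    using assms by (auto simp: tendsto_def)
  then obtain P Q where PQ: "\<forall>\<^sub>F x in nhds 0. P x" "\<forall>\<^sub>F y in nhds 0. Q y"
    "\<And>x y. P x \<Longrightarrow> Q y \<Longrightarrow> x + y \<in> U"
    unfolding eventually_prod_filter by auto
  obtain A where A: "open A" "0 \<in> A" "\<And>x. x \<in> A \<Longrightarrow> P x"
    using PQ(1) by (auto simp: eventually_nhds)
  obtain B where B: "open B" "0 \<in> B" "\<And>x. x \<in> B \<Longrightarrow> Q x"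
    using PQ(2) by (auto simp: eventually_nhds)
  define W where "W = A \<inter> B"
  define V where "V = W \<inter> uminus -` W"
  have W: "open W" "0 \<in> W" unfolding W_def using A B by auto
  have "continuous_on UNIV (uminus :: 'a \<Rightarrow> 'a)" by (intro continuous_intros)
  then have "open (uminus -` W)"
    using continuous_on_open_vimage[of UNIV "uminus :: 'a \<Rightarrow> 'a"] W by auto
  then have "open V" "0 \<in> V" unfolding V_def using W by auto
  moreover have sum: "x + y \<in> U" if "x \<in> V" "y \<in> V" for x y
    using that A B PQ(3) unfolding V_def W_def by blast
  moreover have "V \<subseteq> U" using sum[of _ 0] \<open>0 \<in> V\<close> by auto
  ultimately show thesis by (intro that[of V]) (auto simp: V_def)
qed

lemma tendsto_iff_diff:
  fixes f :: "'b \<Rightarrow> 'a::topological_ab_group_add"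
  shows "(f \<longlongrightarrow> l) F \<longleftrightarrow> ((\<lambda>x. f x - l) \<longlongrightarrow> 0) F"
  using tendsto_add_const_iff[of l "\<lambda>x. f x - l" 0 F] by simp

lemma tendsto_0_iff_nhd:
  "(f \<longlongrightarrow> (0::'a::topological_ab_group_add)) F \<longleftrightarrow>
    (\<forall>U. open U \<longrightarrow> 0 \<in> U \<longrightarrow> (\<forall>\<^sub>F x in F. f x \<in> U))"
  by (simp add: tendsto_def)

lemma additive_continuous:
  fixes f :: "'a::topological_ab_group_add \<Rightarrow> 'b::topological_ab_group_add"
  assumes "Modules.additive f" "(f \<longlongrightarrow> 0) (nhds 0)"
  shows "continuous_on UNIV f"
proof -
  interpret Modules.additive f by fact
  have "(f \<longlongrightarrow> f x) (nhds x)" for x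
  proof -
    have "((\<lambda>y. y - x) \<longlongrightarrow> 0) (nhds x)"
      using tendsto_iff_diff[of "\<lambda>y. y" x] filterlim_ident by blast
    from filterlim_compose[OF assms(2) this] show ?thesis
      by (subst tendsto_iff_diff) (simp add: diff)
  qed
  then show ?thesis
    by (auto simp: continuous_on_def intro: tendsto_mono[OF at_within_le_nhds])
qed

section \<open>Metrization of first countable topological abelian groups\<close>

text \<open>
For a sequence \<open>U\<close> of neighbourhoods with \<open>U (Suc n) + U (Suc n) \<subseteq> U n\<close>, the set \<open>dyadic_nhd U n k\<close> is
meant as the ball of radius \<open>k / 2 ^ n\<close>: it is the sum of the \<open>U j\<close> over the positions \<open>j\<close> of the
binary digits \<open>1\<close> of \<open>k / 2 ^ n\<close>. A radius of \<open>1\<close> or more stands for the whole group, which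
bounds the resulting norm by \<open>1\<close>.
\<close>

fun dyadic_nhd :: "(nat \<Rightarrow> 'a::ab_group_add set) \<Rightarrow> nat \<Rightarrow> nat \<Rightarrow> 'a set" where
  "dyadic_nhd U 0 k = (if k = 0 then {0} else UNIV)"
| "dyadic_nhd U (Suc n) k =
    (if even k then dyadic_nhd U n (k div 2)
     else {x + u |x u. x \<in> dyadic_nhd U n (k div 2) \<and> u \<in> U (Suc n)})"

locale halving_base =
  fixes U :: "nat \<Rightarrow> 'a::{topological_ab_group_add, t2_space} set"
  assumes open_U: "open (U n)"
    and zero_U: "0 \<in> U n"
    and minus_U: "x \<in> U n \<Longrightarrow> - x \<in> U n"
    and add_U: "x \<in> U (Suc n) \<Longrightarrow> y \<in> U (Suc n) \<Longrightarrow> x + y \<in> U n"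
    and base_U: "open W \<Longrightarrow> 0 \<in> W \<Longrightarrow> \<exists>n. U n \<subseteq> W"
begin

text \<open>
Adding \<open>U n\<close> to a ball whose last digit is already \<open>1\<close> produces a carry: two copies of \<open>U n\<close> fit
into one copy of the preceding neighbourhood.
\<close>

lemma dyadic_nhd_Suc_right:
  "x \<in> dyadic_nhd U n k \<Longrightarrow> u \<in> U n \<Longrightarrow> x + u \<in> dyadic_nhd U n (Suc k)"
proof (induction n arbitrary: x u k)
  case (Suc n)
  show ?case
  proof (cases "even k")
    case True
    then show ?thesis using Suc.prems by auto
  next
    case False
    then obtain y v where yv: "x = y + v" "y \<in> dyadic_nhd U n (k div 2)" "v \<in> U (Suc n)"
      using Suc.prems by auto
    then have "y + (v + u) \<in> dyadic_nhd U n (Suc (k div 2))"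
      using Suc.IH Suc.prems add_U by blast
    with False yv show ?thesis by (simp add: add.assoc)
  qed
qed simp

lemma dyadic_nhd_mono: "k \<le> l \<Longrightarrow> dyadic_nhd U n k \<subseteq> dyadic_nhd U n l"
proof (induction l rule: dec_induct)
  case (step l)
  then show ?case using dyadic_nhd_Suc_right[of _ n l 0] zero_U by fastforce
qed simp

text \<open>
Digitwise addition with carry: this becomes the triangle inequality.
\<close>

lemma dyadic_nhd_add:
  "x \<in> dyadic_nhd U n k \<Longrightarrow> y \<in> dyadic_nhd U n l \<Longrightarrow> x + y \<in> dyadic_nhd U n (k + l)"
proof (induction n arbitrary: x y k l)
  case (Suc n)
  obtain x' u where x: "x = x' + u" "x' \<in> dyadic_nhd U n (k div 2)"
    "u \<in> U (Suc n)" "even k \<Longrightarrow> u = 0"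
    proof (cases "even k")
    case True
    then show thesis using Suc.prems(1) zero_U that[of x 0] by simp
  qed (use Suc.prems(1) that in auto)
  obtain y' v where y: "y = y' + v" "y' \<in> dyadic_nhd U n (l div 2)"
    "v \<in> U (Suc n)" "even l \<Longrightarrow> v = 0"
    proof (cases "even l")
    case True
    then show thesis using Suc.prems(2) zero_U that[of y 0] by simp
  qed (use Suc.prems(2) that in auto)
  have xy': "x' + y' \<in> dyadic_nhd U n (k div 2 + l div 2)" using Suc.IH x y by blast
  show ?case
  proof (cases "even k \<and> even l")
    case True
    then show ?thesis using xy' x y by (simp add: div_add)
  next
    case notboth: False
    show ?thesis
    proof (cases "odd k \<and> odd l")
      case True
      then obtain a b where ab: "k = 2 * a + 1" "l = 2 * b + 1" by (meson oddE)
      have "x' + y' + (u + v) \<in> dyadic_nhd U n (Suc (k div 2 + l div 2))"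
        using dyadic_nhd_Suc_right[OF xy'] add_U x y by blast
      moreover have "x' + y' + (u + v) = x + y" using x y by (simp add: algebra_simps)
      ultimately show ?thesis using ab by simp
    next
      case False
      have *: "u + v \<in> U (Suc n)" "odd (k + l)" using notboth False x y by auto
      have "k div 2 + l div 2 = (k + l) div 2" using notboth False by presburger
      moreover have "x + y = (x' + y') + (u + v)" using x y by (simp add: algebra_simps)
      ultimately show ?thesis using * xy' by auto
    qed
  qed
qed auto

lemma dyadic_nhd_minus: "x \<in> dyadic_nhd U n k \<Longrightarrow> - x \<in> dyadic_nhd U n k"
proof (induction n arbitrary: x k)
  case (Suc n)
  show ?case
  proof (cases "even k")
    case False
    then obtain y v where yv: "x = y + v" "y \<in> dyadic_nhd U n (k div 2)" "v \<in> U (Suc n)"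
      using Suc.prems by auto
    then have "- x = - y + - v" "- y \<in> dyadic_nhd U n (k div 2)" "- v \<in> U (Suc n)"
      using Suc.IH minus_U by auto
    with False show ?thesis unfolding dyadic_nhd.simps if_not_P[OF False] by blast
  qed (use Suc in auto)
qed (auto split: if_splits)

text \<open>
The ball depends only on the fraction \<open>k / 2 ^ n\<close>, so two balls can be compared at a common level.
\<close>

lemma dyadic_nhd_refine: "dyadic_nhd U (m + n) (2 ^ m * k) = dyadic_nhd U n k"
  by (induction m) (auto simp: mult.assoc)

lemma dyadic_nhd_one: "dyadic_nhd U (Suc n) 1 = U (Suc n)"
proof -
  have "dyadic_nhd U n 0 = {0}" by (induction n) auto
  then show ?thesis by auto
qed

definition group_norm :: "'a \<Rightarrow> real"
  where "group_norm x = Inf {real k / 2 ^ n |k n. x \<in> dyadic_nhd U n k}"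

lemma group_norm_le: "x \<in> dyadic_nhd U n k \<Longrightarrow> group_norm x \<le> real k / 2 ^ n"
  unfolding group_norm_def by (rule cInf_lower) (auto intro!: bdd_belowI[of _ 0])

lemma group_norm_less:
  assumes "group_norm x < c"
  obtains k n where "x \<in> dyadic_nhd U n k" "real k / 2 ^ n < c"
proof -
  have "x \<in> dyadic_nhd U 0 1" by simp
  then have "{real k / 2 ^ n |k n. x \<in> dyadic_nhd U n k} \<noteq> {}" by blast
  from cInf_lessD[OF this, of c] assms that show thesis unfolding group_norm_def by auto
qed

lemma group_norm_nonneg: "0 \<le> group_norm x"
proof (rule ccontr)
  assume "\<not> 0 \<le> group_norm x"
  then obtain k :: nat and n :: nat where "real k / 2 ^ n < 0"
    using group_norm_less[of x 0] by (metis not_le)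
  then show False by (simp add: divide_less_0_iff)
qed

lemma group_norm_triangle: "group_norm (x + y) \<le> group_norm x + group_norm y"
proof (rule field_le_epsilon)
  fix e :: real assume "0 < e"
  then have "group_norm x < group_norm x + e / 2" "group_norm y < group_norm y + e / 2" by auto
  then obtain k n l m where
    x: "x \<in> dyadic_nhd U n k" "real k / 2 ^ n < group_norm x + e / 2" and
    y: "y \<in> dyadic_nhd U m l" "real l / 2 ^ m < group_norm y + e / 2"
    by (metis group_norm_less)
  have "x \<in> dyadic_nhd U (m + n) (2 ^ m * k)" "y \<in> dyadic_nhd U (m + n) (2 ^ n * l)"
    using x y dyadic_nhd_refine[of m n k] dyadic_nhd_refine[of n m l]
    by (simp_all add: add.commute)
  then have "group_norm (x + y) \<le> real (2 ^ m * k + 2 ^ n * l) / 2 ^ (m + n)"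
    by (intro group_norm_le dyadic_nhd_add)
  also have "\<dots> = real k / 2 ^ n + real l / 2 ^ m"
    by (simp add: power_add field_simps)
  finally show "group_norm (x + y) \<le> group_norm x + group_norm y + e" using x y by linarith
qed

lemma group_norm_minus: "group_norm (- x) = group_norm x"
proof -
  have "- x \<in> dyadic_nhd U n k \<longleftrightarrow> x \<in> dyadic_nhd U n k" for n k
    using dyadic_nhd_minus[of x n k] dyadic_nhd_minus[of "- x" n k] by auto
  then show ?thesis unfolding group_norm_def by simp
qed

text \<open>
Together with \<open>group_norm_le\<close> this shows that the sets \<open>U (Suc n)\<close> and the balls of radius
\<open>1 / 2 ^ Suc n\<close> interlace, hence that the norm induces the given topology.
\<close>

lemma group_norm_less_imp_mem:
  assumes "group_norm x < 1 / 2 ^ Suc n" shows "x \<in> U (Suc n)"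
proof -
  from assms obtain k m where km: "x \<in> dyadic_nhd U m k" "real k / 2 ^ m < 1 / 2 ^ Suc n"
    by (rule group_norm_less)
  have "real k * 2 ^ Suc n < 2 ^ m" using km(2) by (simp add: field_simps)
  then have "2 ^ Suc n * k \<le> 2 ^ m"
    by (metis (mono_tags) less_imp_le mult.commute of_nat_le_iff of_nat_mult of_nat_numeral of_nat_power)
  then have "dyadic_nhd U (Suc n + m) (2 ^ Suc n * k) \<subseteq> dyadic_nhd U (m + Suc n) (2 ^ m * 1)"
    using dyadic_nhd_mono by (simp only: add.commute mult_1_right)
  then show ?thesis using km(1) unfolding dyadic_nhd_refine dyadic_nhd_one by blast
qed

lemma group_norm_eq_0: "group_norm x = 0 \<longleftrightarrow> x = 0"
proof
  assume x: "group_norm x = 0"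
  show "x = 0"
  proof (rule ccontr)
    assume "x \<noteq> 0"
    then obtain W where W: "open W" "0 \<in> W" "x \<notin> W" using t1_space[of 0 x] by auto
    then obtain n where "U n \<subseteq> W" using base_U by blast
    moreover have "x \<in> U (Suc n)" using group_norm_less_imp_mem[of x n] x by simp
    ultimately show False using add_U[of x n 0] zero_U W by auto
  qed
next
  assume "x = 0"
  then show "group_norm x = 0"
    using group_norm_le[of x 0 0] group_norm_nonneg[of x] by simp
qed

sublocale Metric_space UNIV "\<lambda>x y. group_norm (x - y)"
proof
  show "group_norm (x - y) = group_norm (y - x)" for x y
    using group_norm_minus[of "x - y"] by simp
  show "group_norm (x - z) \<le> group_norm (x - y) + group_norm (y - z)" for x y z
    using group_norm_triangle[of "x - y" "y - z"] by simp
qed (auto simp: group_norm_nonneg group_norm_eq_0)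

lemma mtopology_eq_euclidean: "mtopology = euclidean"
proof -
  have "openin mtopology S \<longleftrightarrow> open S" for S
  proof
    assume S: "openin mtopology S"
    show "open S"
    proof (subst open_subopen, intro ballI)
      fix x assume "x \<in> S"
      with S obtain r where r: "r > 0" "mball x r \<subseteq> S" unfolding openin_mtopology by blast
      obtain n where n: "(1 / 2) ^ n < r" using real_arch_pow_inv[of r "1/2"] r by auto
      have "{y. - x + y \<in> U (Suc n)} \<subseteq> S"
      proof
        fix y assume "y \<in> {y. - x + y \<in> U (Suc n)}"
        then have "- x + y \<in> dyadic_nhd U (Suc n) 1" unfolding dyadic_nhd_one by simp
        from group_norm_le[OF this] have "group_norm (- x + y) \<le> 1 / 2 ^ Suc n" by simp
        also have "\<dots> \<le> (1 / 2) ^ n" by (simp add: power_divide field_simps)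
        finally have "group_norm (x - y) < r"
          using n group_norm_minus[of "x - y"] by simp
        then show "y \<in> S" using r by auto
      qed
      moreover have "open {y. - x + y \<in> U (Suc n)}" by (rule open_translate[OF open_U])
      ultimately show "\<exists>T. open T \<and> x \<in> T \<and> T \<subseteq> S" using zero_U by fastforce
    qed
  next
    assume S: "open S"
    show "openin mtopology S"
      unfolding openin_mtopology
    proof (intro conjI allI impI)
      fix x assume "x \<in> S"
      then obtain n where n: "U n \<subseteq> {u. x + u \<in> S}"
        using base_U[OF open_translate[OF S, of x]] by auto
      have "mball x (1 / 2 ^ Suc n) \<subseteq> S"
      proof
        fix y assume "y \<in> mball x (1 / 2 ^ Suc n)"
        then have "y - x \<in> U (Suc n)"
          using group_norm_less_imp_mem[of "y - x" n] group_norm_minus[of "x - y"] by simp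
        then have "y - x \<in> U n" using add_U[of "y - x" n 0] zero_U by simp
        then show "y \<in> S" using n by auto
      qed
      then show "\<exists>r>0. mball x r \<subseteq> S" by (intro exI[of _ "1 / 2 ^ Suc n"]) simp
    qed simp
  qed
  then show ?thesis by (simp add: topology_eq)
qed

lemma metrizable: "metrizable_space (euclidean :: 'a topology)"
  using metrizable_space_mtopology unfolding mtopology_eq_euclidean .

end

lemma metrizable_nhds_zero_base:
  assumes "metrizable_space (euclidean :: 'a topology)"
  obtains V :: "nat \<Rightarrow> 'a::topological_ab_group_add set" where "\<And>n. open (V n)" "\<And>n. 0 \<in> V n"
    "\<And>W. open W \<Longrightarrow> 0 \<in> W \<Longrightarrow> \<exists>n. V n \<subseteq> W"
proof -
  obtain M and d :: "'a \<Rightarrow> 'a \<Rightarrow> real" where M: "Metric_space M d"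
    and eq: "(euclidean :: 'a topology) = Metric_space.mtopology M d"
    using assms unfolding metrizable_space_def by blast
  interpret Metric_space M d by fact
  have "M = UNIV" using eq topspace_mtopology by (metis topspace_euclidean)
  show thesis
  proof (rule that[of "\<lambda>n. mball 0 (inverse (real (Suc n)))"])
    show "open (mball 0 (inverse (real (Suc n))))" for n
      using openin_mball[of 0] unfolding eq[symmetric] by simp
    show "0 \<in> mball 0 (inverse (real (Suc n)))" for n using \<open>M = UNIV\<close> centre_in_mball_iff[of 0] by simp
    fix W :: "'a set" assume "open W" "0 \<in> W"
    then obtain r where r: "r > 0" "mball 0 r \<subseteq> W"
      using openin_mtopology[of W] unfolding eq[symmetric] by auto
    obtain n where "inverse (real (Suc n)) < r" using reals_Archimedean r by blast
    then show "\<exists>n. mball 0 (inverse (real (Suc n))) \<subseteq> W"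
      using r mball_subset_concentric[of "inverse (real (Suc n))" r 0] by (intro exI[of _ n]) auto
  qed
qed

section \<open>Extensions of metrizable groups\<close>

context group_extension
begin

lemma p_i [simp]: "p (i y) = 0"
  using exact by auto

lemma kernelE:
  assumes "p x = 0"
  obtains y where "x = i y"
  using assms exact by auto

lemma open_image_p: "open U \<Longrightarrow> open (p ` U)"
  using open_map_p surj_p unfolding open_map_def by auto

lemma open_vimage_i: "open U \<Longrightarrow> open (i -` U)"
  using continuous_on_open_vimage[of UNIV i] continuous_i by auto

lemma open_vimage_p: "open U \<Longrightarrow> open (p -` U)"
  using continuous_on_open_vimage[of UNIV p] continuous_p by auto

text \<open>
The subspace topology on the kernel is its own one, so smallness in \<open>Y\<close> can be tested in \<open>X\<close>.
\<close>

lemma open_extends_i: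
  assumes "open V"
  obtains A where "open A" "i -` A = V"
proof -
  have "openin (top_of_set (range i)) (i ` V)"
    using open_map_i assms unfolding open_map_def by auto
  then obtain A where A: "open A" "i ` V = range i \<inter> A" unfolding openin_open by blast
  have "i -` A = V"
  proof
    show "i -` A \<subseteq> V"
    proof
      fix y assume "y \<in> i -` A"
      then have "i y \<in> i ` V" using A(2) by auto
      then show "y \<in> V" using inj_i by (simp add: inj_image_mem_iff)
    qed
    show "V \<subseteq> i -` A" using A(2) by auto
  qed
  with A that show thesis by blast
qed

lemmas i_hom = additive.zero[OF additive_i] additive.add[OF additive_i]
  additive.diff[OF additive_i] additive.minus[OF additive_i]

lemmas p_hom = additive.zero[OF additive_p] additive.add[OF additive_p]
  additive.diff[OF additive_p] additive.minus[OF additive_p]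

text \<open>
Metrizability is a three-space property. By the metrization above it suffices to find a countable
neighbourhood base of zero. The sequence \<open>U\<close> is chosen so that it shrinks to zero inside the kernel
and in the quotient. It is then a base in \<open>X\<close> because a group topology cannot be made coarser without
changing it on the kernel or on the quotient: an element of a late \<open>U m\<close> agrees modulo the kernel with an element of a given
neighbourhood, and the difference is a small element of the kernel.
\<close>

proposition metrizable_middle:
  assumes "metrizable_space (euclidean :: 'y topology)"
    and "metrizable_space (euclidean :: 'z topology)"
  shows "metrizable_space (euclidean :: 'x topology)"
proof -
  obtain V :: "nat \<Rightarrow> 'y set" where V: "\<And>n. open (V n)" "\<And>n. 0 \<in> V n"
    "\<And>W. open W \<Longrightarrow> 0 \<in> W \<Longrightarrow> \<exists>n. V n \<subseteq> W"
    by (rule metrizable_nhds_zero_base[OF assms(1)]) blast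
  obtain W :: "nat \<Rightarrow> 'z set" where W: "\<And>n. open (W n)" "\<And>n. 0 \<in> W n"
    "\<And>N. open N \<Longrightarrow> 0 \<in> N \<Longrightarrow> \<exists>n. W n \<subseteq> N"
    by (rule metrizable_nhds_zero_base[OF assms(2)]) blast
  have "\<exists>A. open A \<and> i -` A = V n" for n
    by (rule open_extends_i[OF V(1)[of n]]) blast
  then obtain A where A: "\<And>n. open (A n)" "\<And>n. i -` A n = V n" by metis
  have A0: "0 \<in> A n" for n using A(2)[of n] V(2)[of n] i_hom(1) by (metis vimageD)
  define G where "G n = A n \<inter> p -` W n" for n
  have G: "open (G n)" "0 \<in> G n" for n
    unfolding G_def using A A0 W open_vimage_p p_hom(1) by auto
  let ?P = "\<lambda>(n::nat) S. open S \<and> (0::'x) \<in> S \<and> (\<forall>x\<in>S. - x \<in> S)"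
  let ?Q = "\<lambda>n S T. \<forall>x\<in>T. \<forall>y\<in>T. x + y \<in> S \<inter> G n"
  have "\<exists>U. \<forall>n. ?P n (U n) \<and> ?Q n (U n) (U (Suc n))"
  proof (rule dependent_nat_choice)
    show "\<exists>S. ?P 0 S" by (rule exI[of _ UNIV]) auto
    fix S n assume "?P n S"
    \<comment> \<open>each new set, even after doubling, lies in the previous one and in the constraints of stage \<open>n\<close>\<close>
    then have "open (S \<inter> G n)" "0 \<in> S \<inter> G n" using G[of n] by auto
    then obtain T where "open T" "0 \<in> T" "\<And>x. x \<in> T \<Longrightarrow> - x \<in> T" "T \<subseteq> S \<inter> G n"
      "\<And>x y. x \<in> T \<Longrightarrow> y \<in> T \<Longrightarrow> x + y \<in> S \<inter> G n"
      by (rule symmetric_halving) blast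
    then show "\<exists>T. ?P (Suc n) T \<and> ?Q n S T" by (intro exI[of _ T]) simp
  qed
  then obtain U where U: "\<And>n. open (U n)" "\<And>n. 0 \<in> U n" "\<And>n x. x \<in> U n \<Longrightarrow> - x \<in> U n"
    and add: "\<And>n x y. x \<in> U (Suc n) \<Longrightarrow> y \<in> U (Suc n) \<Longrightarrow> x + y \<in> U n \<inter> G n"
    by metis
  have sub: "U (Suc n) \<subseteq> U n \<inter> G n" for n
    using add[of _ n 0] U(2) by auto
  have anti: "U n \<subseteq> U m" if "m \<le> n" for m n
    using lift_Suc_antimono_le[of U, OF _ that] sub by blast
  have "\<exists>n. U n \<subseteq> N" if N: "open N" "0 \<in> N" for N
  proof -
    obtain M where M: "open M" "0 \<in> M" "\<And>x y. x \<in> M \<Longrightarrow> y \<in> M \<Longrightarrow> x + y \<in> N"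
      by (rule symmetric_halving[OF N]) blast
    have "open (i -` M)" "0 \<in> i -` M" using M open_vimage_i i_hom(1) by auto
    then obtain n where n: "V n \<subseteq> i -` M" using V(3) by blast
    have "open (p ` (M \<inter> U (Suc (Suc n))))" by (intro open_image_p open_Int M U)
    moreover have "0 \<in> p ` (M \<inter> U (Suc (Suc n)))"
      by (rule image_eqI[of _ _ 0]) (use M U p_hom(1) in auto)
    ultimately obtain l where l: "W l \<subseteq> p ` (M \<inter> U (Suc (Suc n)))" using W(3) by blast
    have "U (max (Suc l) (Suc (Suc n))) \<subseteq> N"
    proof
      fix x assume "x \<in> U (max (Suc l) (Suc (Suc n)))"
      then have x: "x \<in> U (Suc l)" "x \<in> U (Suc (Suc n))" using anti by (meson max.cobounded1 max.cobounded2 subsetD)+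
      then have "p x \<in> W l" using sub unfolding G_def by blast
      then obtain w where w: "w \<in> M" "w \<in> U (Suc (Suc n))" "p x = p w" using l by blast
      then have "p (x - w) = 0" by (simp add: p_hom)
      then obtain y where y: "x - w = i y" by (rule kernelE)
      \<comment> \<open>one step of the sequence pays for the difference, the next one for the constraint of stage \<open>n\<close>\<close>
      have "x - w \<in> U (Suc n)" using add[OF x(2) U(3)[OF w(2)]] by simp
      then have "i y \<in> A n" using sub y unfolding G_def by auto
      then have "i y \<in> M" using A(2) n by blast
      then show "x \<in> N" using M(3)[OF _ w(1), of "i y"] y by (simp add: algebra_simps)
    qed
    then show ?thesis by blast
  qed
  then interpret halving_base U
    using U add by unfold_locales auto
  show ?thesis by (rule metrizable)
qed

end

section \<open>Lifting limits along an extension with complete kernel\<close>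

lemma cauchy_filter_iff:
  fixes F :: "'a::topological_ab_group_add filter"
  shows "F \<times>\<^sub>F F \<le> group_uniformity \<longleftrightarrow>
    (\<forall>U. open U \<longrightarrow> 0 \<in> U \<longrightarrow> (\<exists>P. eventually P F \<and> (\<forall>x y. P x \<longrightarrow> P y \<longrightarrow> y - x \<in> U)))"
    (is "?L \<longleftrightarrow> ?R")
proof
  assume L: ?L
  show ?R
  proof (intro allI impI)
    fix U :: "'a set" assume "open U" "0 \<in> U"
    then have "\<forall>\<^sub>F x in nhds 0. x \<in> U" by (rule eventually_nhds_in_open)
    then have "\<forall>\<^sub>F z in group_uniformity. case z of (x, y) \<Rightarrow> y - x \<in> U"
      unfolding group_uniformity_def eventually_filtercomap by auto
    with L have "\<forall>\<^sub>F z in F \<times>\<^sub>F F. case z of (x, y) \<Rightarrow> y - x \<in> U"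
      by (simp add: le_filter_def)
    then obtain P Q where "eventually P F" "eventually Q F" "\<And>x y. P x \<Longrightarrow> Q y \<Longrightarrow> y - x \<in> U"
      unfolding eventually_prod_filter by auto
    then show "\<exists>P. eventually P F \<and> (\<forall>x y. P x \<longrightarrow> P y \<longrightarrow> y - x \<in> U)"
      by (intro exI[of _ "\<lambda>x. P x \<and> Q x"]) (auto intro: eventually_conj)
  qed
next
  assume R: ?R
  show ?L
  proof (rule filter_leI)
    fix T :: "'a \<times> 'a \<Rightarrow> bool" assume "eventually T group_uniformity"
    then obtain U where U: "open U" "0 \<in> U" "\<And>x y. y - x \<in> U \<Longrightarrow> T (x, y)"
      unfolding group_uniformity_def eventually_filtercomap eventually_nhds by force
    with R obtain P where "eventually P F" "\<And>x y. P x \<Longrightarrow> P y \<Longrightarrow> y - x \<in> U" by blast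
    with U show "eventually T (F \<times>\<^sub>F F)"
      unfolding eventually_prod_filter by blast
  qed
qed

lemma cauchy_filterE:
  fixes F :: "'a::topological_ab_group_add filter"
  assumes "F \<times>\<^sub>F F \<le> group_uniformity" "open U" "0 \<in> U"
  obtains P where "eventually P F" "\<And>x y. P x \<Longrightarrow> P y \<Longrightarrow> y - x \<in> U"
proof -
  have "\<exists>P. eventually P F \<and> (\<forall>x y. P x \<longrightarrow> P y \<longrightarrow> y - x \<in> U)"
    using assms(1)[unfolded cauchy_filter_iff] assms(2,3) by simp
  then show thesis by (elim exE conjE) (rule that, assumption, simp)
qed

context group_extension
begin

text \<open>
A Cauchy filter on \<open>X\<close> converges as soon as its image in \<open>Z\<close> does, because the
remaining freedom lies in the complete kernel. After translation by a lift \<open>x0\<close> of the limit, the elements of the filter are close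
to the kernel, because \<open>p\<close> is open; removing a small error \<open>u\<close> moves them into the kernel, where
they form the Cauchy filter \<open>H\<close>.
\<close>

proposition cauchy_filter_lifts_limit:
  assumes complete: "complete_group TYPE('y)"
    and F: "F \<noteq> bot" "F \<times>\<^sub>F F \<le> group_uniformity" "filtermap p F \<le> nhds z"
  shows "\<exists>x. F \<le> nhds x"
proof -
  obtain x0 where x0: "p x0 = z" using surj_p by (metis surjD)
  define H where "H = filtercomap i (filtermap (\<lambda>(x, u). x - x0 - u) (F \<times>\<^sub>F nhds 0))"
  have eventually_H: "eventually T H \<longleftrightarrow> (\<exists>P B. eventually P F \<and> open B \<and> 0 \<in> B \<and>
      (\<forall>x u y. P x \<longrightarrow> u \<in> B \<longrightarrow> i y = x - x0 - u \<longrightarrow> T y))" (is "_ \<longleftrightarrow> ?R T") for T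
  proof
    assume "eventually T H"
    then obtain Q where Q: "eventually Q (filtermap (\<lambda>(x, u). x - x0 - u) (F \<times>\<^sub>F nhds 0))"
      "\<And>y. Q (i y) \<Longrightarrow> T y" unfolding H_def eventually_filtercomap by blast
    then obtain P P' where P: "eventually P F" "eventually P' (nhds 0)"
      "\<And>x u. P x \<Longrightarrow> P' u \<Longrightarrow> Q (x - x0 - u)"
      unfolding eventually_filtermap eventually_prod_filter by auto
    then obtain B where "open B" "0 \<in> B" "\<And>u. u \<in> B \<Longrightarrow> P' u" unfolding eventually_nhds by auto
    with P Q show "?R T" by (intro exI[of _ P] exI[of _ B]) (metis)
  next
    assume "?R T"
    then obtain P B where PB: "eventually P F" "open B" "0 \<in> B"
      "\<And>x u y. P x \<Longrightarrow> u \<in> B \<Longrightarrow> i y = x - x0 - u \<Longrightarrow> T y" by blast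
    have "\<forall>\<^sub>F u in nhds 0. u \<in> B" using PB by (intro eventually_nhds_in_open)
    with PB have "\<forall>\<^sub>F w in F \<times>\<^sub>F nhds 0. \<forall>y. i y = fst w - x0 - snd w \<longrightarrow> T y"
      unfolding eventually_prod_filter by (metis fst_conv snd_conv)
    then show "eventually T H"
      unfolding H_def eventually_filtercomap eventually_filtermap
      by (intro exI[of _ "\<lambda>w. \<forall>y. i y = w \<longrightarrow> T y"]) (auto simp: case_prod_beta)
  qed
  \<comment> \<open>openness of \<open>p\<close> makes the trace on the kernel a proper filter\<close>
  have meet: "\<exists>x u y. P x \<and> u \<in> B \<and> i y = x - x0 - u"
    if P: "eventually P F" and B: "open B" "0 \<in> B" for P B
  proof -
    have op: "open {w. - z + w \<in> p ` B}" by (intro open_translate open_image_p B)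
    have "z \<in> {w. - z + w \<in> p ` B}" using B p_hom(1) by (auto intro!: image_eqI[of 0 p 0])
    from eventually_nhds_in_open[OF op this] have "\<forall>\<^sub>F w in nhds z. - z + w \<in> p ` B" by simp
    from filter_leD[OF F(3) this] have "\<forall>\<^sub>F x in F. - z + p x \<in> p ` B"
      by (simp add: eventually_filtermap)
    with P have "\<forall>\<^sub>F x in F. P x \<and> - z + p x \<in> p ` B" by (rule eventually_conj)
    from eventually_happens'[OF F(1) this] obtain x where x: "P x" "- z + p x \<in> p ` B" by auto
    then obtain u where u: "u \<in> B" "- z + p x = p u" by blast
    then have "p (x - x0 - u) = 0" using x0 by (simp add: p_hom algebra_simps)
    then obtain y where "x - x0 - u = i y" by (rule kernelE)
    with x u show ?thesis by metis
  qed
  have "H \<noteq> bot" unfolding trivial_limit_def eventually_H using meet by blast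
  moreover have "H \<times>\<^sub>F H \<le> group_uniformity"
    unfolding cauchy_filter_iff eventually_H
  proof (intro allI impI)
    fix V :: "'y set" assume V: "open V" "0 \<in> V"
    obtain A where A: "open A" "i -` A = V" by (rule open_extends_i[OF V(1)])
    have "0 \<in> A" using A(2) V i_hom(1) by (metis vimageD)
    obtain B where B: "open B" "0 \<in> B" "\<And>x. x \<in> B \<Longrightarrow> - x \<in> B" 
      "\<And>x y. x \<in> B \<Longrightarrow> y \<in> B \<Longrightarrow> x + y \<in> A"
      by (rule symmetric_halving[OF A(1) \<open>0 \<in> A\<close>]) blast
    obtain C where C: "open C" "0 \<in> C" "\<And>x. x \<in> C \<Longrightarrow> - x \<in> C" "C \<subseteq> B"
      "\<And>x y. x \<in> C \<Longrightarrow> y \<in> C \<Longrightarrow> x + y \<in> B" by (rule symmetric_halving[OF B(1,2)]) blast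
    obtain P where P: "eventually P F" "\<And>x x'. P x \<Longrightarrow> P x' \<Longrightarrow> x' - x \<in> B"
      by (rule cauchy_filterE[OF F(2) B(1,2)]) (rule that)
    let ?T = "\<lambda>y. \<exists>x u. P x \<and> u \<in> C \<and> i y = x - x0 - u"
    have T: "y' - y \<in> V"
      if *: "P x" "u \<in> C" "i y = x - x0 - u" "P x'" "u' \<in> C" "i y' = x' - x0 - u'" for x u y x' u' y'
    proof -
      have "(x' - x) \<in> B" using P(2) * by blast
      moreover have "u + - u' \<in> B" using C(5)[OF *(2) C(3)[OF *(5)]] .
      ultimately have "(x' - x) + (u + - u') \<in> A" by (rule B(4))
      moreover have "i (y' - y) = (x' - x) + (u + - u')" unfolding i_hom *(3,6) by simp
      ultimately have "y' - y \<in> i -` A" by simp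
      then show ?thesis unfolding A(2) .
    qed
    have "\<forall>y y'. ?T y \<longrightarrow> ?T y' \<longrightarrow> y' - y \<in> V" 
      by (intro allI impI, elim exE conjE, rule T)
    moreover have "\<exists>P B. eventually P F \<and> open B \<and> 0 \<in> B \<and>
      (\<forall>x u y. P x \<longrightarrow> u \<in> B \<longrightarrow> i y = x - x0 - u \<longrightarrow> ?T y)"
      by (rule exI[of _ P], rule exI[of _ C]) (use P(1) C(1,2) in auto)
    ultimately show "\<exists>T. (\<exists>P B. eventually P F \<and> open B \<and> 0 \<in> B \<and>
      (\<forall>x u y. P x \<longrightarrow> u \<in> B \<longrightarrow> i y = x - x0 - u \<longrightarrow> T y)) \<and> (\<forall>y y'. T y \<longrightarrow> T y' \<longrightarrow> y' - y \<in> V)"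
      by (intro exI[of _ ?T] conjI)
  qed
  ultimately have "\<exists>y. H \<le> nhds y"
    using complete unfolding complete_group_def by simp
  then obtain y where y: "H \<le> nhds y" ..
  have "F \<le> nhds (x0 + i y)"
  proof (rule filter_leI)
    fix T assume "eventually T (nhds (x0 + i y))"
    then obtain S where S: "open S" "x0 + i y \<in> S" "\<And>x. x \<in> S \<Longrightarrow> T x"
      unfolding eventually_nhds by auto
    have N: "open {u. x0 + i y + u \<in> S}" "0 \<in> {u. x0 + i y + u \<in> S}"
      using S open_translate by auto
    obtain B where B: "open B" "0 \<in> B" "\<And>u v. u \<in> B \<Longrightarrow> v \<in> B \<Longrightarrow> x0 + i y + (u + v) \<in> S"
      by (rule symmetric_halving[OF N]) blast
    obtain C where C: "open C" "0 \<in> C" "C \<subseteq> B" "\<And>u v. u \<in> C \<Longrightarrow> v \<in> C \<Longrightarrow> u + v \<in> B"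
      by (rule symmetric_halving[OF B(1,2)]) blast
    obtain P where P: "eventually P F" "\<And>x x'. P x \<Longrightarrow> P x' \<Longrightarrow> x' - x \<in> C"
      by (rule cauchy_filterE[OF F(2) C(1,2)]) (rule that)
    have op: "open {v. - y + v \<in> i -` C}" by (intro open_translate open_vimage_i C)
    have "y \<in> {v. - y + v \<in> i -` C}" using C i_hom(1) by simp
    from eventually_nhds_in_open[OF op this] have "\<forall>\<^sub>F v in nhds y. - y + v \<in> i -` C" by simp
    from filter_leD[OF y this] have "\<forall>\<^sub>F v in H. - y + v \<in> i -` C" .
    then obtain P' B' where P': "eventually P' F" "open B'" "0 \<in> B'"
      "\<And>x u v. P' x \<Longrightarrow> u \<in> B' \<Longrightarrow> i v = x - x0 - u \<Longrightarrow> - y + v \<in> i -` C"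
      unfolding eventually_H by blast
    have "0 \<in> B' \<inter> C" using P' C by simp
    from meet[OF eventually_conj[OF P(1) P'(1)] open_Int[OF P'(2) C(1)] this]
    obtain x u v where x: "P x" "P' x" "u \<in> B'" "u \<in> C" "i v = x - x0 - u" by auto
    have "- i y + i v \<in> C" using P'(4)[OF x(2,3,5)] by (simp add: i_hom)
    then have *: "u + (- i y + i v) \<in> B" using C(4) x by blast
    have "T x'" if P': "P x'" for x'
    proof -
      have "x0 + i y + ((u + (- i y + i v)) + (x' - x)) \<in> S"
        using B(3)[OF *] P(2)[OF x(1) P'] C(3) by blast
      moreover have "x0 + i y + ((u + (- i y + i v)) + (x' - x)) = x'"
        unfolding x(5) by (simp add: algebra_simps)
      ultimately have "x' \<in> S" by (simp only:)
      then show ?thesis by (rule S(3))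
    qed
    then show "eventually T F" by (rule eventually_mono[OF P(1)])
  qed
  then show ?thesis by (rule exI)
qed

end

section \<open>Integer multiples\<close>

text \<open>
A difference of two finite sums covers both signs in one formula, so that homomorphisms commute
with multiples by additivity alone.
\<close>

definition int_mult :: "int \<Rightarrow> 'a::ab_group_add \<Rightarrow> 'a"
  where "int_mult k x = (\<Sum>_<nat k. x) - (\<Sum>_<nat (- k). x)"

lemma int_mult_0 [simp]: "int_mult 0 x = 0"
  and int_mult_1 [simp]: "int_mult 1 x = x"
  and int_mult_zero [simp]: "int_mult k 0 = 0"
  and int_mult_of_nat: "int_mult (int n) x = (\<Sum>_<n. x)"
  by (simp_all add: int_mult_def)

lemma int_mult_Suc: "int_mult (k + 1) x = int_mult k x + x"
proof (cases "k \<ge> 0")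
  case True
  then have "nat (k + 1) = Suc (nat k)" "nat (- k) = 0" "nat (- (k + 1)) = 0" by auto
  then show ?thesis unfolding int_mult_def by simp
next
  case False
  then have "nat (- k) = Suc (nat (- (k + 1)))" "nat k = 0" "nat (k + 1) = 0" by auto
  then show ?thesis unfolding int_mult_def by simp
qed

lemma int_mult_pred: "int_mult (k - 1) x = int_mult k x - x"
  using int_mult_Suc[of "k - 1" x] by simp

lemma int_mult_left_add: "int_mult (k + l) x = int_mult k x + int_mult l x"
proof (induction l rule: int_induct[where k = 0])
  case (step1 l)
  then show ?case using int_mult_Suc[of "k + l" x] int_mult_Suc[of l x] by (simp add: add.assoc)
next
  case (step2 l)
  then show ?case by (simp add: add_diff_eq int_mult_pred)
qed simp

lemma int_mult_left_diff: "int_mult (k - l) x = int_mult k x - int_mult l x"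
  using int_mult_left_add[of "k - l" l x] by simp

lemma int_mult_hom: "Modules.additive f \<Longrightarrow> f (int_mult k x) = int_mult k (f x)"
  unfolding int_mult_def by (simp add: additive.diff additive.sum)

lemma additive_int_mult: "Modules.additive (int_mult k)"
  by unfold_locales (simp add: int_mult_def sum.distrib)

lemmas int_mult_add = additive.add[OF additive_int_mult]
  and int_mult_diff = additive.diff[OF additive_int_mult]

lemma int_mult_mult: "int_mult (k * l) x = int_mult k (int_mult l x)"
proof (induction k rule: int_induct[where k = 0])
  case (step1 k)
  have "int_mult ((k + 1) * l) x = int_mult (k * l) x + int_mult l x"
    by (simp only: distrib_right mult_1_left int_mult_left_add)
  then show ?case using step1 by (simp add: int_mult_Suc)
next
  case (step2 k)
  have "int_mult ((k - 1) * l) x = int_mult (k * l) x - int_mult l x"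
    by (simp only: left_diff_distrib mult_1_left int_mult_left_diff)
  then show ?case using step2 by (simp add: int_mult_pred)
qed simp

lemma int_mult_scaleR: "int_mult k (x :: 'a::real_vector) = of_int k *\<^sub>R x"
proof -
  have sum: "(\<Sum>_<n. x) = real n *\<^sub>R x" for n :: nat
    by (induction n) (simp_all add: scaleR_left_distrib)
  show ?thesis unfolding int_mult_def sum by (cases "k \<ge> 0") simp_all
qed

lemma continuous_on_int_mult:
  "continuous_on UNIV (int_mult k :: 'a \<Rightarrow> 'a::topological_ab_group_add)"
  unfolding int_mult_def by (intro continuous_intros)

section \<open>Neighbourhoods in topological vector spaces\<close>

context topological_vector_space
begin

lemma tendsto_scale:
  assumes "(f \<longlongrightarrow> r) F" "(g \<longlongrightarrow> x) F"
  shows "((\<lambda>t. scale (f t) (g t)) \<longlongrightarrow> scale r x) F"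
proof -
  have "isCont (\<lambda>(r, x). scale r x) (r, x)"
    using continuous_scale by (simp add: continuous_on_eq_continuous_at)
  from isCont_tendsto_compose[OF this tendsto_Pair[OF assms]] show ?thesis by simp
qed

text \<open>
Continuity at \<open>(0, 0)\<close> only controls scalars below some \<open>d\<close>; dilating the neighbourhood by \<open>d / 2\<close>
extends this to the whole unit interval.
\<close>

lemma balanced_nhd:
  assumes "open U" "0 \<in> U"
  obtains W where "open W" "0 \<in> W" "\<And>w t. w \<in> W \<Longrightarrow> \<bar>t\<bar> \<le> 1 \<Longrightarrow> scale t w \<in> U"
proof -
  have "((\<lambda>w. scale (fst w) (snd w)) \<longlongrightarrow> scale 0 0) (nhds 0 \<times>\<^sub>F nhds 0)"
    by (intro tendsto_scale filterlim_fst filterlim_snd)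
  then have "\<forall>\<^sub>F w in nhds 0 \<times>\<^sub>F nhds 0. scale (fst w) (snd w) \<in> U"
    using assms by (intro topological_tendstoD) auto
  then obtain P Q where P: "\<forall>\<^sub>F r in nhds 0. P r" and Q: "\<forall>\<^sub>F x in nhds 0. Q x"
    and PQ: "\<And>r x. P r \<Longrightarrow> Q x \<Longrightarrow> scale r x \<in> U"
    unfolding eventually_prod_filter by auto
  obtain d where d: "d > 0" "\<And>r. \<bar>r\<bar> < d \<Longrightarrow> P r"
    using P unfolding eventually_nhds_metric by (auto simp: dist_real_def)
  obtain B where B: "open B" "0 \<in> B" "\<And>x. x \<in> B \<Longrightarrow> Q x"
    using Q unfolding eventually_nhds by auto
  let ?W = "scale (2 / d) -` B"
  have "continuous_on UNIV (scale (2 / d))"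
    unfolding continuous_on_def by (auto intro!: tendsto_scale)
  then have "open ?W" using B(1) continuous_on_open_vimage[of UNIV "scale (2 / d)"] by auto
  moreover have "scale t w \<in> U" if "w \<in> ?W" "\<bar>t\<bar> \<le> 1" for w t
  proof -
    have "\<bar>t * (d / 2)\<bar> < d" using that(2) d(1) by (simp add: abs_mult)
    then have "scale (t * (d / 2)) (scale (2 / d) w) \<in> U"
      using that(1) by (intro PQ d(2) B(3)) auto
    then show ?thesis using d(1) by simp
  qed
  ultimately show thesis using B(2) by (intro that[of ?W]) auto
qed

end

section \<open>Averaging over a cyclic group\<close>

text \<open>
The identity behind the main estimate. The indices \<open>k + l\<close> are read modulo \<open>n\<close>, and each
wrap-around is paid for by one summand \<open>n a\<close>. For fixed \<open>k\<close> the translates \<open>c (k + l)\<close> run through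
all values of \<open>c\<close> and cancel against the \<open>c l\<close>, while \<open>k\<close> of the \<open>n\<close> indices wrap around.
What remains is \<open>k n a - n c k\<close>.
\<close>

lemma sum_cyclic_defect:
  fixes c :: "nat \<Rightarrow> 'a::ab_group_add"
  assumes k: "k < n"
  shows "(\<Sum>l<n. (if k + l < n then c (k + l) else c (k + l - n) + int_mult (int n) a) - c k - c l)
    = int_mult (int n) (int_mult (int k) a - c k)"
proof -
  let ?x = "int_mult (int n) a"
  have rotate: "(\<Sum>l<n. if k + l < n then c (k + l) else c (k + l - n)) = (\<Sum>l<n. c l)"
    by (rule sum.reindex_bij_witness[of _ "\<lambda>l. if k \<le> l then l - k else l + n - k"
          "\<lambda>l. if k + l < n then k + l else k + l - n"]) (use k in auto)
  have "(\<Sum>l<n. if k + l < n then 0 else ?x) = (\<Sum>l\<in>{n - k..<n}. ?x)"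
    by (rule sum.mono_neutral_cong_right) (use k in auto)
  also have "\<dots> = (\<Sum>l<k. ?x)"
    by (rule sum.reindex_bij_witness[of _ "\<lambda>l. l + (n - k)" "\<lambda>l. l - (n - k)"]) (use k in auto)
  also have "\<dots> = int_mult (int n) (int_mult (int k) a)"
    unfolding int_mult_of_nat[symmetric] int_mult_mult[symmetric] by (simp add: mult.commute)
  finally have wrap: "(\<Sum>l<n. if k + l < n then 0 else ?x) = int_mult (int n) (int_mult (int k) a)" .
  have "(\<Sum>l<n. (if k + l < n then c (k + l) else c (k + l - n) + ?x) - c k - c l)
    = (\<Sum>l<n. (if k + l < n then c (k + l) else c (k + l - n)) + (if k + l < n then 0 else ?x) - c k - c l)"
    by (rule sum.cong) auto
  also have "\<dots> = int_mult (int n) (int_mult (int k) a) - int_mult (int n) (c k)"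
    unfolding sum_subtractf sum.distrib rotate wrap int_mult_of_nat[symmetric] by simp
  finally show ?thesis by (simp only: int_mult_diff)
qed

locale frechet_extension = group_extension i p
  for i :: "'y::{real_vector, topological_ab_group_add, t2_space}
        \<Rightarrow> 'x::{topological_ab_group_add, t2_space}"
    and p :: "'x \<Rightarrow> 'z::{real_vector, topological_ab_group_add, t2_space}" +
  assumes frechet_Y: "frechet_space TYPE('y)"
    and tvs_Z: "topological_vector_space ((*\<^sub>R) :: real \<Rightarrow> 'z \<Rightarrow> 'z)"
begin

sublocale Y: topological_vector_space "(*\<^sub>R) :: real \<Rightarrow> 'y \<Rightarrow> 'y"
  using frechet_Y by (simp add: frechet_space_def)

sublocale Z: topological_vector_space "(*\<^sub>R) :: real \<Rightarrow> 'z \<Rightarrow> 'z"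
  by (rule tvs_Z)

lemma convex_nhd:
  assumes "open (V :: 'y set)" "0 \<in> V"
  obtains D C where "open D" "0 \<in> D" "D \<subseteq> C" "convex C" "C \<subseteq> V"
proof -
  have "neighbourhood_base_of convex (euclidean :: 'y topology)"
    using frechet_Y by (simp add: frechet_space_def)
  then have "\<exists>D C. open D \<and> convex C \<and> 0 \<in> D \<and> D \<subseteq> C \<and> C \<subseteq> V"
    using assms by (simp add: neighbourhood_base_of)
  then show thesis using that by blast
qed

lemma p_int_mult: "p (int_mult k x) = of_int k *\<^sub>R p x"
  using int_mult_hom[OF additive_p] int_mult_scaleR by metis

lemma i_scaleR_of_int: "i (of_int k *\<^sub>R y) = int_mult k (i y)"
  using int_mult_hom[OF additive_i] int_mult_scaleR by metis

text \<open>
The main estimate, and the place where local convexity of the kernel enters: fractions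
\<open>(k / n) x\<close> of a small \<open>x\<close> are small, uniformly in \<open>n\<close> and \<open>k \<le> n\<close>.

Choose small lifts \<open>c l\<close> of the points \<open>(l / n) p x\<close>; they exist because \<open>p\<close> is open and \<open>Z\<close> has
balanced neighbourhoods. Modulo the wrap-around correction, \<open>c\<close> is additive on the cyclic group of
order \<open>n\<close> up to defects, which lie in the kernel and are small. By the identity above, \<open>(k / n) x\<close>
differs from the small element \<open>c k\<close> by the average of these defects over the cyclic group, and an
average of elements of a convex set stays in that set.
\<close>

lemma fraction_stays_small:
  assumes U: "open (U :: 'x set)" "0 \<in> U"
  obtains U' where "open U'" "0 \<in> U'"
    "\<And>a n k. int_mult (int n) a \<in> U' \<Longrightarrow> 0 < n \<Longrightarrow> k \<le> n \<Longrightarrow> int_mult (int k) a \<in> U"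
proof -
  obtain V1 where V1: "open V1" "0 \<in> V1" "V1 \<subseteq> U" "\<And>x y. x \<in> V1 \<Longrightarrow> y \<in> V1 \<Longrightarrow> x + y \<in> U"
    by (rule symmetric_halving[OF U]) blast
  have "open (i -` V1)" "0 \<in> i -` V1" using V1 open_vimage_i i_hom(1) by auto
  then obtain D C where D: "open D" "0 \<in> D" "D \<subseteq> C" "convex C" "C \<subseteq> i -` V1"
    by (rule convex_nhd)
  obtain A where A: "open A" "i -` A = D" by (rule open_extends_i[OF D(1)])
  have "0 \<in> A" using A(2) D(2) i_hom(1) by (metis vimageD)
  obtain V2 where V2: "open V2" "0 \<in> V2" "\<And>x y. x \<in> V2 \<Longrightarrow> y \<in> V2 \<Longrightarrow> x + y \<in> A"
    by (rule symmetric_halving[OF A(1) \<open>0 \<in> A\<close>]) blast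
  obtain V3 where V3: "open V3" "0 \<in> V3" "\<And>x. x \<in> V3 \<Longrightarrow> - x \<in> V3"
    "\<And>x y. x \<in> V3 \<Longrightarrow> y \<in> V3 \<Longrightarrow> x + y \<in> V2"
    by (rule symmetric_halving[OF V2(1,2)]) blast
  define V4 where "V4 = V3 \<inter> V1"
  have V4: "open V4" "0 \<in> V4" unfolding V4_def using V1 V3 by auto
  have "0 \<in> p ` V4" by (rule image_eqI[of _ _ 0]) (use V4 p_hom(1) in auto)
  then obtain W where W: "open W" "0 \<in> W" "\<And>w t. w \<in> W \<Longrightarrow> \<bar>t\<bar> \<le> 1 \<Longrightarrow> t *\<^sub>R w \<in> p ` V4"
    using Z.balanced_nhd[OF open_image_p[OF V4(1)]] by metis
  show thesis
  proof (rule that[of "V4 \<inter> p -` W"])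
    show "open (V4 \<inter> p -` W)" "0 \<in> V4 \<inter> p -` W"
      using V4 W open_vimage_p p_hom(1) by auto
    fix a n k
    assume x: "int_mult (int n) a \<in> V4 \<inter> p -` W" and n: "0 < n" and k: "k \<le> n"
    define x where "x = int_mult (int n) a"
    have pa: "p a = (1 / real n) *\<^sub>R p x" using n by (simp add: x_def p_int_mult)
    show "int_mult (int k) a \<in> U"
    proof (cases "k = n")
      case True
      then show ?thesis using x V1(3) by (auto simp: V4_def)
    next
      case False
      then have k: "k < n" using k by simp
      have "\<exists>u\<in>V4. p u = (real l / real n) *\<^sub>R p x" if "l < n" for l
        using W(3)[of "p x" "real l / real n"] x that unfolding x_def by auto
      then obtain c where c: "\<And>l. l < n \<Longrightarrow> c l \<in> V4" "\<And>l. l < n \<Longrightarrow> p (c l) = (real l / real n) *\<^sub>R p x"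
        by metis
      \<comment> \<open>a defect has four terms from \<open>V3\<close> at most, which is why \<open>A\<close> was halved twice\<close>
      let ?d = "\<lambda>l. (if k + l < n then c (k + l) else c (k + l - n) + x) - c k - c l"
      have "\<exists>v\<in>D. i v = ?d l" if l: "l < n" for l
      proof -
        have "p (?d l) = 0"
        proof (cases "k + l < n")
          case True
          then show ?thesis using k l
            by (simp add: p_hom c add_divide_distrib scaleR_left_distrib)
        next
          case False
          then have "real (k + l - n) / real n = real k / real n + real l / real n - 1"
            using n by (simp add: of_nat_diff field_simps)
          then show ?thesis using k l False
            by (simp add: p_hom c scaleR_left_distrib scaleR_left_diff_distrib)
        qed
        then obtain v where v: "?d l = i v" by (rule kernelE)
        have "x \<in> V3" "c k \<in> V3" "c l \<in> V3" using x c(1) k l by (auto simp: V4_def x_def)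
        have e: "(if k + l < n then c (k + l) else c (k + l - n) + x) \<in> V2"
        proof (cases "k + l < n")
          case True
          then have "c (k + l) + 0 \<in> V2" using c(1) V3(2,4) unfolding V4_def by blast
          then show ?thesis using True by simp
        next
          case False
          then have "c (k + l - n) \<in> V3" using c(1) k l unfolding V4_def by auto
          then show ?thesis using False V3(4) \<open>x \<in> V3\<close> by simp
        qed
        have "- c k + - c l \<in> V2" using V3(3,4) \<open>c k \<in> V3\<close> \<open>c l \<in> V3\<close> by blast
        from V2(3)[OF e this] have "i v \<in> A" unfolding v[symmetric] by (simp add: algebra_simps)
        then show ?thesis using A(2) v by auto
      qed
      then obtain v where v: "\<And>l. l < n \<Longrightarrow> v l \<in> D" "\<And>l. l < n \<Longrightarrow> i (v l) = ?d l" by metis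
      have "p (int_mult (int k) a - c k) = 0"
        by (simp add: p_hom p_int_mult pa c(2)[OF k])
      then obtain g where g: "int_mult (int k) a - c k = i g" by (rule kernelE)
      have "i (real n *\<^sub>R g) = int_mult (int n) (i g)" using i_scaleR_of_int[of "int n" g] by simp
      also have "\<dots> = (\<Sum>l<n. ?d l)"
        unfolding g[symmetric] x_def by (rule sum_cyclic_defect[OF k, symmetric])
      also have "\<dots> = i (\<Sum>l<n. v l)"
        unfolding additive.sum[OF additive_i] by (rule sum.cong) (use v in auto)
      finally have "real n *\<^sub>R g = (\<Sum>l<n. v l)" using inj_i by (simp add: inj_def)
      then have "(1 / real n) *\<^sub>R (real n *\<^sub>R g) = (1 / real n) *\<^sub>R (\<Sum>l<n. v l)" by simp
      then have "g = (\<Sum>l<n. (1 / real n) *\<^sub>R v l)" using n by (simp add: scaleR_sum_right)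
      also have "\<dots> \<in> C" by (rule convex_sum) (use D v n in auto)
      finally have "i g \<in> V1" using D(5) by auto
      moreover have "c k \<in> V1" using c(1)[OF k] unfolding V4_def by simp
      ultimately have "i g + c k \<in> U" by (rule V1(4))
      then show ?thesis using g by (simp add: algebra_simps)
    qed
  qed
qed

end

section \<open>Division by powers of two\<close>

context frechet_extension
begin

text \<open>
An extension of a torsion-free divisible group by another one is torsion-free and divisible again.
\<close>

lemma int_mult_cancel:
  assumes "m \<noteq> 0" "int_mult m a = int_mult m (b :: 'x)"
  shows "a = b"
proof -
  have 0: "int_mult m (a - b) = 0" using assms by (simp add: int_mult_diff)
  then have "of_int m *\<^sub>R p (a - b) = 0" using p_int_mult[of m "a - b"] p_hom(1) by simp
  then have "p (a - b) = 0" using assms by simp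
  then obtain y where y: "a - b = i y" by (rule kernelE)
  have "i (of_int m *\<^sub>R y) = i 0" using 0 i_scaleR_of_int[of m y] y i_hom(1) by simp
  then have "of_int m *\<^sub>R y = 0" using inj_i by (simp only: inj_eq)
  then show ?thesis using y assms i_hom(1) by simp
qed

lemma ex_fraction: "m \<noteq> 0 \<Longrightarrow> \<exists>a :: 'x. int_mult m a = x"
proof -
  assume m: "m \<noteq> 0"
  obtain w where w: "p w = (1 / of_int m) *\<^sub>R p x" using surj_p by (metis surjD)
  have "p (x - int_mult m w) = 0" using m by (simp add: p_hom p_int_mult w)
  then obtain y where y: "x - int_mult m w = i y" by (rule kernelE)
  have "int_mult m (w + i ((1 / of_int m) *\<^sub>R y)) = int_mult m w + i (of_int m *\<^sub>R (1 / of_int m) *\<^sub>R y)"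
    by (simp only: int_mult_add i_scaleR_of_int)
  also have "\<dots> = x" using m y by (simp add: algebra_simps)
  finally show ?thesis by blast
qed

definition dyadic_part :: "nat \<Rightarrow> 'x \<Rightarrow> 'x"
  where "dyadic_part n x = (SOME a. int_mult (2 ^ n) a = x)"

lemma int_mult_dyadic_part: "int_mult (2 ^ n) (dyadic_part n x) = x"
  unfolding dyadic_part_def by (rule someI_ex, rule ex_fraction) simp

lemma dyadic_part_eqI: "int_mult (2 ^ n) a = x \<Longrightarrow> dyadic_part n x = a"
  by (rule int_mult_cancel[of "2 ^ n"]) (simp_all add: int_mult_dyadic_part)

lemma dyadic_part_add: "dyadic_part n (x + y) = dyadic_part n x + dyadic_part n y"
  by (rule dyadic_part_eqI) (simp add: int_mult_add int_mult_dyadic_part)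

lemma int_mult_dyadic_part_split: "int_mult (2 ^ n) (dyadic_part (m + n) x) = dyadic_part m x"
proof (rule dyadic_part_eqI[symmetric])
  have "int_mult (2 ^ m) (int_mult (2 ^ n) (dyadic_part (m + n) x)) = int_mult (2 ^ (m + n)) (dyadic_part (m + n) x)"
    by (simp only: int_mult_mult[symmetric] power_add)
  then show "int_mult (2 ^ m) (int_mult (2 ^ n) (dyadic_part (m + n) x)) = x"
    by (simp only: int_mult_dyadic_part)
qed

lemma dyadic_part_dyadic_part: "dyadic_part n (dyadic_part m x) = dyadic_part (m + n) x"
  by (rule dyadic_part_eqI) (rule int_mult_dyadic_part_split)

lemma p_dyadic_part: "p (dyadic_part n x) = (1 / 2 ^ n) *\<^sub>R p x"
proof -
  have "p x = 2 ^ n *\<^sub>R p (dyadic_part n x)"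
    using p_int_mult[of "2 ^ n" "dyadic_part n x"] by (simp add: int_mult_dyadic_part)
  then show ?thesis by simp
qed

lemma dyadic_part_i: "dyadic_part n (i y) = i ((1 / 2 ^ n) *\<^sub>R y)"
proof (rule dyadic_part_eqI)
  have "int_mult (2 ^ n) (i ((1 / 2 ^ n) *\<^sub>R y)) = i (of_int (2 ^ n) *\<^sub>R (1 / 2 ^ n) *\<^sub>R y)"
    by (simp only: i_scaleR_of_int)
  then show "int_mult (2 ^ n) (i ((1 / 2 ^ n) *\<^sub>R y)) = i y" by simp
qed

lemma dyadic_fraction_stays_small:
  assumes U: "open U" "(0 :: 'x) \<in> U"
  obtains U' where "open U'" "0 \<in> U'"
    "\<And>x n k. x \<in> U' \<Longrightarrow> 0 \<le> k \<Longrightarrow> k \<le> 2 ^ n \<Longrightarrow> int_mult k (dyadic_part n x) \<in> U"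
proof -
  obtain U' where U': "open U'" "0 \<in> U'"
    "\<And>a n k. int_mult (int n) a \<in> U' \<Longrightarrow> 0 < n \<Longrightarrow> k \<le> n \<Longrightarrow> int_mult (int k) a \<in> U"
    by (rule fraction_stays_small[OF U]) blast
  have "int_mult k (dyadic_part n x) \<in> U" if "x \<in> U'" "0 \<le> k" "k \<le> 2 ^ n" for x n k
  proof -
    have "int_mult (int (2 ^ n)) (dyadic_part n x) \<in> U'"
      using that int_mult_dyadic_part by simp
    moreover have "nat k \<le> 2 ^ n" using that by (simp add: nat_le_iff)
    ultimately show ?thesis using U'(3)[of "2 ^ n" "dyadic_part n x" "nat k"] that by simp
  qed
  with U' show thesis by (intro that[of U']) auto
qed

text \<open>
The main estimate speaks of small \<open>x\<close> only. For a general \<open>x\<close>, some \<open>x / 2 ^ m\<close> has a small image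
in \<open>Z\<close> and so equals a small \<open>x'\<close> up to an element \<open>y\<close> of the kernel. The estimate handles further
division of \<open>x'\<close>, and the vector space topology of the kernel that of \<open>y\<close>.
\<close>

lemma dyadic_part_tendsto_0: "(\<lambda>n. dyadic_part n x) \<longlonglongrightarrow> 0"
  unfolding tendsto_0_iff_nhd
proof (intro allI impI)
  fix U :: "'x set" assume U: "open U" "0 \<in> U"
  obtain V where V: "open V" "0 \<in> V" "\<And>x y. x \<in> V \<Longrightarrow> y \<in> V \<Longrightarrow> x + y \<in> U"
    by (rule symmetric_halving[OF U]) blast
  obtain V' where V': "open V'" "0 \<in> V'"
    "\<And>x n k. x \<in> V' \<Longrightarrow> 0 \<le> k \<Longrightarrow> k \<le> 2 ^ n \<Longrightarrow> int_mult k (dyadic_part n x) \<in> V"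
    by (rule dyadic_fraction_stays_small[OF V(1,2)]) blast
  have half: "(\<lambda>n. 1 / 2 ^ n) \<longlonglongrightarrow> (0 :: real)"
    using LIMSEQ_power_zero[of "1 / 2 :: real"] by (simp add: power_divide)
  have "(\<lambda>n. (1 / 2 ^ n) *\<^sub>R p x) \<longlonglongrightarrow> 0 *\<^sub>R p x"
    by (intro Z.tendsto_scale half tendsto_const)
  moreover have "0 \<in> p ` V'" by (rule image_eqI[of _ _ 0]) (use V' p_hom(1) in auto)
  ultimately have "\<forall>\<^sub>F n in sequentially. (1 / 2 ^ n) *\<^sub>R p x \<in> p ` V'"
    using open_image_p[OF V'(1)] by (intro topological_tendstoD) auto
  then obtain m where "(1 / 2 ^ m) *\<^sub>R p x \<in> p ` V'"
    unfolding eventually_sequentially by blast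
  then obtain x' where x': "x' \<in> V'" "p x' = (1 / 2 ^ m) *\<^sub>R p x" by auto
  then have "p (dyadic_part m x - x') = 0" by (simp add: p_hom p_dyadic_part)
  then obtain y where y: "dyadic_part m x - x' = i y" by (rule kernelE)
  have "(\<lambda>n. (1 / 2 ^ n) *\<^sub>R y) \<longlonglongrightarrow> 0 *\<^sub>R y"
    by (intro Y.tendsto_scale half tendsto_const)
  then have "\<forall>\<^sub>F n in sequentially. (1 / 2 ^ n) *\<^sub>R y \<in> i -` V"
    using open_vimage_i[OF V(1)] V(2) i_hom(1) by (intro topological_tendstoD) auto
  then obtain N where N: "\<And>n. n \<ge> N \<Longrightarrow> i ((1 / 2 ^ n) *\<^sub>R y) \<in> V"
    unfolding eventually_sequentially by auto
  have "dyadic_part n x \<in> U" if "n \<ge> m + N" for n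
  proof -
    define k where "k = n - m"
    have n: "n = m + k" "k \<ge> N" using that by (auto simp: k_def)
    have "dyadic_part m x = x' + i y" using y by (simp add: algebra_simps)
    then have "dyadic_part n x = dyadic_part k (x' + i y)"
      unfolding n by (simp only: dyadic_part_dyadic_part[symmetric])
    also have "\<dots> = int_mult 1 (dyadic_part k x') + i ((1 / 2 ^ k) *\<^sub>R y)"
      by (simp add: dyadic_part_add dyadic_part_i)
    also have "\<dots> \<in> U" using V'(3)[OF x'(1), of 1 k] N n(2) by (intro V(3)) auto
    finally show ?thesis .
  qed
  then show "\<forall>\<^sub>F n in sequentially. dyadic_part n x \<in> U"
    unfolding eventually_sequentially by blast
qed

end

section \<open>The real scalar multiplication\<close>

text \<open>
Refining the binary truncation of a real number by \<open>d\<close> digits adds a fraction of the last digit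
between \<open>0\<close> and \<open>1\<close>; these are the fractions covered by the main estimate.
\<close>

lemma floor_pow_split:
  fixes u :: real
  shows "0 \<le> \<lfloor>u * 2 ^ d\<rfloor> - 2 ^ d * \<lfloor>u\<rfloor>" "\<lfloor>u * 2 ^ d\<rfloor> - 2 ^ d * \<lfloor>u\<rfloor> \<le> 2 ^ d"
proof -
  have "of_int (2 ^ d * \<lfloor>u\<rfloor>) \<le> u * 2 ^ d"
    using mult_right_mono[of "of_int \<lfloor>u\<rfloor>" u "2 ^ d"] by (simp add: mult.commute)
  then show "0 \<le> \<lfloor>u * 2 ^ d\<rfloor> - 2 ^ d * \<lfloor>u\<rfloor>" by (simp add: le_floor_iff)
  have "u * 2 ^ d \<le> (of_int \<lfloor>u\<rfloor> + 1) * 2 ^ d" by (rule mult_right_mono) (linarith, simp)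
  then have "u * 2 ^ d \<le> of_int (2 ^ d * \<lfloor>u\<rfloor> + 2 ^ d)" by (simp add: algebra_simps)
  then have "\<lfloor>u * 2 ^ d\<rfloor> \<le> 2 ^ d * \<lfloor>u\<rfloor> + 2 ^ d"
    using floor_mono[of "u * 2 ^ d" "of_int (2 ^ d * \<lfloor>u\<rfloor> + 2 ^ d)"] by (simp only: floor_of_int)
  then show "\<lfloor>u * 2 ^ d\<rfloor> - 2 ^ d * \<lfloor>u\<rfloor> \<le> 2 ^ d" by simp
qed

lemma dyadic_floor_tendsto: "(\<lambda>n. of_int \<lfloor>t * 2 ^ n\<rfloor> / 2 ^ n) \<longlonglongrightarrow> (t :: real)"
proof (rule tendsto_sandwich)
  have "(\<lambda>n. t - (1 / 2) ^ n) \<longlonglongrightarrow> t - 0"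
    by (intro tendsto_intros LIMSEQ_power_zero) auto
  then show "(\<lambda>n. t - (1 / 2) ^ n) \<longlonglongrightarrow> t" by simp
  have "t - (1 / 2) ^ n \<le> of_int \<lfloor>t * 2 ^ n\<rfloor> / 2 ^ n" for n
  proof -
    have "(t * 2 ^ n - 1) / 2 ^ n \<le> of_int \<lfloor>t * 2 ^ n\<rfloor> / 2 ^ n"
      by (rule divide_right_mono) (linarith, simp)
    then show ?thesis by (simp add: diff_divide_distrib power_divide)
  qed
  then show "\<forall>\<^sub>F n in sequentially. t - (1 / 2) ^ n \<le> of_int \<lfloor>t * 2 ^ n\<rfloor> / 2 ^ n" by simp
  show "\<forall>\<^sub>F n in sequentially. of_int \<lfloor>t * 2 ^ n\<rfloor> / 2 ^ n \<le> t"
    by (simp add: field_simps)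
qed simp

context frechet_extension
begin

definition dyadic_scale :: "real \<Rightarrow> 'x \<Rightarrow> nat \<Rightarrow> 'x"
  where "dyadic_scale t x n = int_mult \<lfloor>t * 2 ^ n\<rfloor> (dyadic_part n x)"

lemma p_dyadic_scale: "p (dyadic_scale t x n) = (of_int \<lfloor>t * 2 ^ n\<rfloor> / 2 ^ n) *\<^sub>R p x"
  by (simp add: dyadic_scale_def p_int_mult p_dyadic_part)

text \<open>
The difference of two approximations is a fraction \<open>j / 2 ^ (n - m)\<close> of \<open>x / 2 ^ m\<close>, which is small
by the main estimate once \<open>x / 2 ^ m\<close> is.
\<close>

lemma dyadic_scale_close:
  assumes U': "\<And>x n k. x \<in> U' \<Longrightarrow> 0 \<le> k \<Longrightarrow> k \<le> 2 ^ n \<Longrightarrow> int_mult k (dyadic_part n x) \<in> U"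
    and x: "dyadic_part m x \<in> U'" and n: "m \<le> n"
  shows "dyadic_scale t x n - dyadic_scale t x m \<in> U"
proof -
  define d where "d = n - m"
  have n: "n = m + d" using n by (simp add: d_def)
  let ?j = "\<lfloor>t * 2 ^ m * 2 ^ d\<rfloor> - 2 ^ d * \<lfloor>t * 2 ^ m\<rfloor>"
  have "dyadic_scale t x m = int_mult (2 ^ d * \<lfloor>t * 2 ^ m\<rfloor>) (dyadic_part n x)"
    unfolding dyadic_scale_def n int_mult_dyadic_part_split[of d m x, symmetric]
      int_mult_mult[symmetric] by (simp only: mult.commute)
  then have "dyadic_scale t x n - dyadic_scale t x m = int_mult ?j (dyadic_part d (dyadic_part m x))"
    unfolding dyadic_scale_def dyadic_part_dyadic_part int_mult_left_diff
    by (simp add: n power_add mult.assoc)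
  moreover have "int_mult ?j (dyadic_part d (dyadic_part m x)) \<in> U"
    by (intro U' x floor_pow_split)
  ultimately show ?thesis by simp
qed

text \<open>
The images of the approximations in \<open>Z\<close> converge to \<open>t p x\<close>, so the Cauchy property gives
convergence although \<open>X\<close> may be incomplete.
\<close>

lemma convergent_dyadic_scale: "convergent (dyadic_scale t x)"
proof -
  let ?F = "filtermap (dyadic_scale t x) sequentially"
  have "?F \<times>\<^sub>F ?F \<le> group_uniformity"
    unfolding cauchy_filter_iff
  proof (intro allI impI)
    fix U :: "'x set" assume U: "open U" "0 \<in> U"
    obtain V where V: "open V" "0 \<in> V" "\<And>x. x \<in> V \<Longrightarrow> - x \<in> V"
      "\<And>x y. x \<in> V \<Longrightarrow> y \<in> V \<Longrightarrow> x + y \<in> U"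
      by (rule symmetric_halving[OF U]) blast
    obtain V' where V': "open V'" "0 \<in> V'"
      "\<And>x n k. x \<in> V' \<Longrightarrow> 0 \<le> k \<Longrightarrow> k \<le> 2 ^ n \<Longrightarrow> int_mult k (dyadic_part n x) \<in> V"
      by (rule dyadic_fraction_stays_small[OF V(1,2)]) blast
    have "\<forall>\<^sub>F n in sequentially. dyadic_part n x \<in> V'"
      using dyadic_part_tendsto_0 V' by (intro topological_tendstoD)
    then obtain m where m: "dyadic_part m x \<in> V'" unfolding eventually_sequentially by blast
    let ?P = "\<lambda>u. u - dyadic_scale t x m \<in> V"
    have "?P (dyadic_scale t x n)" if "n \<ge> m" for n
      by (rule dyadic_scale_close[OF V'(3) m that])
    then have "eventually ?P ?F"
      unfolding eventually_filtermap eventually_sequentially by blast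
    moreover have "v - u \<in> U" if "?P u" "?P v" for u v
      using V(4)[OF that(2) V(3)[OF that(1)]] by simp
    ultimately show "\<exists>P. eventually P ?F \<and> (\<forall>u v. P u \<longrightarrow> P v \<longrightarrow> v - u \<in> U)"
      by (intro exI[of _ ?P]) simp
  qed
  moreover have "filtermap p ?F \<le> nhds (t *\<^sub>R p x)"
    unfolding filtermap_filtermap filterlim_def[symmetric] p_dyadic_scale
    by (intro Z.tendsto_scale dyadic_floor_tendsto tendsto_const)
  moreover have "complete_group TYPE('y)" using frechet_Y by (simp add: frechet_space_def)
  ultimately have "\<exists>l. ?F \<le> nhds l"
    by (intro cauchy_filter_lifts_limit) (simp_all add: filtermap_bot_iff)
  then show ?thesis unfolding convergent_def filterlim_def .
qed

definition scale :: "real \<Rightarrow> 'x \<Rightarrow> 'x"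
  where "scale t x = lim (dyadic_scale t x)"

lemma dyadic_scale_tendsto: "dyadic_scale t x \<longlonglongrightarrow> scale t x"
  using convergent_dyadic_scale unfolding scale_def convergent_LIMSEQ_iff .

lemma scale_eqI: "dyadic_scale t x \<longlonglongrightarrow> l \<Longrightarrow> scale t x = l"
  using dyadic_scale_tendsto LIMSEQ_unique by blast

lemma p_scale: "p (scale t x) = t *\<^sub>R p x"
proof (rule LIMSEQ_unique)
  show "(\<lambda>n. p (dyadic_scale t x n)) \<longlonglongrightarrow> p (scale t x)"
    using continuous_on_tendsto_compose[OF continuous_p dyadic_scale_tendsto] by simp
  show "(\<lambda>n. p (dyadic_scale t x n)) \<longlonglongrightarrow> t *\<^sub>R p x"
    unfolding p_dyadic_scale by (intro Z.tendsto_scale dyadic_floor_tendsto tendsto_const)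
qed

lemma scale_i: "scale t (i y) = i (t *\<^sub>R y)"
proof (rule scale_eqI)
  have "dyadic_scale t (i y) n = i ((of_int \<lfloor>t * 2 ^ n\<rfloor> / 2 ^ n) *\<^sub>R y)" for n
    unfolding dyadic_scale_def dyadic_part_i i_scaleR_of_int[symmetric] by simp
  moreover have "(\<lambda>n. (of_int \<lfloor>t * 2 ^ n\<rfloor> / 2 ^ n) *\<^sub>R y) \<longlonglongrightarrow> t *\<^sub>R y"
    by (intro Y.tendsto_scale dyadic_floor_tendsto tendsto_const)
  from continuous_on_tendsto_compose[OF continuous_i this]
  have "(\<lambda>n. i ((of_int \<lfloor>t * 2 ^ n\<rfloor> / 2 ^ n) *\<^sub>R y)) \<longlonglongrightarrow> i (t *\<^sub>R y)" by simp
  ultimately show "dyadic_scale t (i y) \<longlonglongrightarrow> i (t *\<^sub>R y)" by presburger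
qed

lemma scale_one: "scale 1 x = x"
proof (rule scale_eqI)
  have "\<lfloor>(2::real) ^ n\<rfloor> = 2 ^ n" for n using floor_of_int[of "2 ^ n"] by simp
  then have "dyadic_scale 1 x n = x" for n
    by (simp add: dyadic_scale_def int_mult_dyadic_part)
  then have "dyadic_scale 1 x = (\<lambda>n. x)" by (rule ext)
  then show "dyadic_scale 1 x \<longlonglongrightarrow> x" by simp
qed

lemma additive_scale_right: "Modules.additive (scale t)"
proof
  fix x y
  have "dyadic_scale t (x + y) = (\<lambda>n. dyadic_scale t x n + dyadic_scale t y n)"
    by (rule ext) (simp add: dyadic_scale_def dyadic_part_add int_mult_add)
  then show "scale t (x + y) = scale t x + scale t y"
    by (intro scale_eqI) (simp add: tendsto_add dyadic_scale_tendsto)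
qed

text \<open>
Rounding down is additive up to an error \<open>e\<close> of \<open>0\<close> or \<open>1\<close>, which costs at most one copy of
\<open>x / 2 ^ n\<close>, and this tends to zero.
\<close>

lemma additive_scale_left: "Modules.additive (\<lambda>t. scale t x)"
proof
  fix t u
  have "(\<lambda>n. dyadic_scale (t + u) x n - dyadic_scale t x n - dyadic_scale u x n) \<longlonglongrightarrow> 0"
    unfolding tendsto_0_iff_nhd
  proof (intro allI impI)
    fix U :: "'x set" assume U: "open U" "0 \<in> U"
    have "\<forall>\<^sub>F n in sequentially. dyadic_part n x \<in> U"
      using dyadic_part_tendsto_0 U by (intro topological_tendstoD)
    then show "\<forall>\<^sub>F n in sequentially. dyadic_scale (t + u) x n - dyadic_scale t x n - dyadic_scale u x n \<in> U"
    proof eventually_elim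
      case (elim n)
      define e where "e = \<lfloor>(t + u) * 2 ^ n\<rfloor> - \<lfloor>t * 2 ^ n\<rfloor> - \<lfloor>u * 2 ^ n\<rfloor>"
      have "e = 0 \<or> e = 1" unfolding e_def distrib_right by linarith
      moreover have "dyadic_scale (t + u) x n - dyadic_scale t x n - dyadic_scale u x n
          = int_mult e (dyadic_part n x)"
        unfolding e_def dyadic_scale_def int_mult_left_diff ..
      ultimately show ?case using elim U by auto
    qed
  qed
  moreover have "(\<lambda>n. dyadic_scale (t + u) x n - dyadic_scale t x n - dyadic_scale u x n)
      \<longlonglongrightarrow> scale (t + u) x - scale t x - scale u x"
    by (intro tendsto_diff dyadic_scale_tendsto)
  ultimately have "scale (t + u) x - scale t x - scale u x = 0" using LIMSEQ_unique by blast
  then show "scale (t + u) x = scale t x + scale u x" by (simp add: algebra_simps)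
qed

text \<open>
Trades a small scalar for a small vector: continuity in the scalar at zero is thereby reduced to
the estimate for scalars in the unit interval.
\<close>

lemma scale_dyadic_part: "scale (t * 2 ^ m) (dyadic_part m x) = scale t x"
proof (rule scale_eqI)
  have "dyadic_scale (t * 2 ^ m) (dyadic_part m x) n = dyadic_scale t x (n + m)" for n
    by (simp add: dyadic_scale_def dyadic_part_dyadic_part power_add mult_ac add.commute)
  then have "dyadic_scale (t * 2 ^ m) (dyadic_part m x) = (\<lambda>n. dyadic_scale t x (n + m))" by (rule ext)
  then show "dyadic_scale (t * 2 ^ m) (dyadic_part m x) \<longlonglongrightarrow> scale t x"
    using LIMSEQ_ignore_initial_segment[OF dyadic_scale_tendsto[of t x], of m] by simp
qed

text \<open>
The main estimate in the limit, where it becomes equicontinuity at zero of the multiplications by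
scalars of the unit interval.
\<close>

lemma scale_nhd:
  assumes U: "open U" "(0 :: 'x) \<in> U"
  obtains U' where "open U'" "0 \<in> U'" "\<And>x t. x \<in> U' \<Longrightarrow> \<bar>t\<bar> \<le> 1 \<Longrightarrow> scale t x \<in> U"
proof -
  obtain W where W: "open W" "0 \<in> W" "\<And>x. x \<in> W \<Longrightarrow> - x \<in> W" "W \<subseteq> U"
    by (rule symmetric_halving[OF U]) blast
  obtain V where V: "open V" "0 \<in> V" "\<And>x. x \<in> V \<Longrightarrow> - x \<in> V"
    "\<And>x y. x \<in> V \<Longrightarrow> y \<in> V \<Longrightarrow> x + y \<in> W"
    by (rule symmetric_halving[OF W(1,2)]) blast
  obtain V' where V': "open V'" "0 \<in> V'"
    "\<And>x n k. x \<in> V' \<Longrightarrow> 0 \<le> k \<Longrightarrow> k \<le> 2 ^ n \<Longrightarrow> int_mult k (dyadic_part n x) \<in> V"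
    by (rule dyadic_fraction_stays_small[OF V(1,2)]) blast
  have W_scale: "scale t x \<in> W" if x: "x \<in> V'" and t: "0 \<le> t" "t \<le> 1" for t x
  proof -
    have "((\<lambda>n. dyadic_scale t x n - scale t x) \<longlonglongrightarrow> 0)"
      using dyadic_scale_tendsto tendsto_iff_diff by blast
    then have "\<forall>\<^sub>F n in sequentially. dyadic_scale t x n - scale t x \<in> V"
      using V by (intro topological_tendstoD)
    then obtain n where n: "dyadic_scale t x n - scale t x \<in> V" unfolding eventually_sequentially by blast
    have "t * 2 ^ n \<le> of_int (2 ^ n)" using t by (simp add: mult_left_le_one_le)
    then have "\<lfloor>t * 2 ^ n\<rfloor> \<le> 2 ^ n"
      using floor_mono[of "t * 2 ^ n" "of_int (2 ^ n)"] by (simp only: floor_of_int)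
    then have "dyadic_scale t x n \<in> V"
      unfolding dyadic_scale_def using t by (intro V'(3) x) auto
    from V(4)[OF this V(3)[OF n]] show ?thesis by simp
  qed
  show thesis
  proof (rule that[OF V'(1,2)])
    fix x t assume x: "x \<in> V'" and t: "\<bar>t :: real\<bar> \<le> 1"
    show "scale t x \<in> U"
    proof (cases "t \<ge> 0")
      case True
      then show ?thesis using W_scale[OF x] t W by auto
    next
      case False
      then have "scale (- t) x \<in> W" using W_scale[OF x, where t = "- t"] t by auto
      from W(3)[OF this] have "scale t x \<in> W"
        by (simp add: additive.minus[OF additive_scale_left])
      then show ?thesis using W(4) by auto
    qed
  qed
qed

lemma scale_tendsto_0:
  assumes "(f \<longlongrightarrow> 0) F" "(g \<longlongrightarrow> 0) F"
  shows "((\<lambda>w. scale (f w) (g w)) \<longlongrightarrow> 0) F"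
  unfolding tendsto_0_iff_nhd
proof (intro allI impI)
  fix U :: "'x set" assume U: "open U" "0 \<in> U"
  obtain U' where U': "open U'" "0 \<in> U'" "\<And>x t. x \<in> U' \<Longrightarrow> \<bar>t\<bar> \<le> 1 \<Longrightarrow> scale t x \<in> U"
    by (rule scale_nhd[OF U]) blast
  have "\<forall>\<^sub>F w in F. f w \<in> {- 1<..<1}" using assms(1) by (intro topological_tendstoD) auto
  moreover have "\<forall>\<^sub>F w in F. g w \<in> U'" using assms(2) U' by (intro topological_tendstoD)
  ultimately show "\<forall>\<^sub>F w in F. scale (f w) (g w) \<in> U"
    by eventually_elim (use U' in auto)
qed

lemma continuous_scale_left: "continuous_on UNIV (\<lambda>t. scale t x)"
proof (rule additive_continuous[OF additive_scale_left])
  show "((\<lambda>t. scale t x) \<longlongrightarrow> 0) (nhds 0)"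
    unfolding tendsto_0_iff_nhd
  proof (intro allI impI)
    fix U :: "'x set" assume U: "open U" "0 \<in> U"
    obtain U' where U': "open U'" "0 \<in> U'" "\<And>x t. x \<in> U' \<Longrightarrow> \<bar>t\<bar> \<le> 1 \<Longrightarrow> scale t x \<in> U"
      by (rule scale_nhd[OF U]) blast
    have "\<forall>\<^sub>F n in sequentially. dyadic_part n x \<in> U'"
      using dyadic_part_tendsto_0 U' by (intro topological_tendstoD)
    then obtain m where m: "dyadic_part m x \<in> U'" unfolding eventually_sequentially by blast
    have "\<forall>\<^sub>F t in nhds 0. \<bar>t :: real\<bar> < 1 / 2 ^ m"
      unfolding eventually_nhds_metric by (rule exI[of _ "1 / 2 ^ m"]) (simp add: dist_real_def)
    then show "\<forall>\<^sub>F t in nhds 0. scale t x \<in> U"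
    proof eventually_elim
      case (elim t)
      then have "\<bar>t * 2 ^ m\<bar> \<le> 1" by (simp add: abs_mult field_simps)
      from U'(3)[OF m this] show ?case unfolding scale_dyadic_part .
    qed
  qed
qed

lemma continuous_scale_right: "continuous_on UNIV (scale t)"
proof (rule additive_continuous[OF additive_scale_right])
  obtain m where "\<bar>t\<bar> < 2 ^ m" using real_arch_pow[of 2 "\<bar>t\<bar>"] by auto
  then have m: "\<bar>t / 2 ^ m\<bar> \<le> 1" by (simp add: field_simps)
  have eq: "scale t x = int_mult (2 ^ m) (scale (t / 2 ^ m) x)" for x
  proof -
    have "int_mult (2 ^ m) (scale (t / 2 ^ m) x) = scale (int_mult (2 ^ m) (t / 2 ^ m)) x"
      using int_mult_hom[OF additive_scale_left] by metis
    then show ?thesis by (simp add: int_mult_scaleR)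
  qed
  have "(scale (t / 2 ^ m) \<longlongrightarrow> 0) (nhds 0)"
    unfolding tendsto_0_iff_nhd
  proof (intro allI impI)
    fix U :: "'x set" assume U: "open U" "0 \<in> U"
    obtain U' where U': "open U'" "0 \<in> U'" "\<And>x t. x \<in> U' \<Longrightarrow> \<bar>t\<bar> \<le> 1 \<Longrightarrow> scale t x \<in> U"
      by (rule scale_nhd[OF U]) blast
    show "\<forall>\<^sub>F x in nhds 0. scale (t / 2 ^ m) x \<in> U"
      using eventually_nhds_in_open[OF U'(1,2)] by eventually_elim (rule U'(3)[OF _ m])
  qed
  from continuous_on_tendsto_compose[OF continuous_on_int_mult this, of "2 ^ m"]
  show "(scale t \<longlongrightarrow> 0) (nhds 0)" unfolding eq by simp
qed

text \<open>
Uniqueness of one-parameter subgroups through a given element: \<open>X\<close> is torsion-free, so the value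
at \<open>1\<close> determines the values at dyadic rationals, and these are dense.
\<close>

lemma additive_real_eq_0:
  fixes f :: "real \<Rightarrow> 'x"
  assumes "Modules.additive f" "continuous_on UNIV f" "f 1 = 0"
  shows "f t = 0"
proof (rule LIMSEQ_unique)
  show "(\<lambda>n. f (of_int \<lfloor>t * 2 ^ n\<rfloor> / 2 ^ n)) \<longlonglongrightarrow> f t"
    using continuous_on_tendsto_compose[OF assms(2) dyadic_floor_tendsto] by simp
  have "f (of_int k / 2 ^ n) = 0" for k n
  proof (rule int_mult_cancel[of "2 ^ n"])
    have "int_mult (2 ^ n) (f (of_int k / 2 ^ n)) = f (int_mult (2 ^ n) (of_int k / 2 ^ n))"
      using int_mult_hom[OF assms(1)] by metis
    also have "\<dots> = f (int_mult k 1)" by (simp add: int_mult_scaleR)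
    also have "\<dots> = int_mult k (f 1)" by (rule int_mult_hom[OF assms(1)])
    finally show "int_mult (2 ^ n) (f (of_int k / 2 ^ n)) = int_mult (2 ^ n) 0" using assms(3) by simp
  qed simp
  then show "(\<lambda>n. f (of_int \<lfloor>t * 2 ^ n\<rfloor> / 2 ^ n)) \<longlonglongrightarrow> 0" by simp
qed

text \<open>
Both sides are one-parameter subgroups in \<open>t\<close> with the same value at \<open>1\<close>.
\<close>

lemma scale_scale: "scale t (scale u x) = scale (t * u) x"
proof -
  let ?f = "\<lambda>t. scale t (scale u x) - scale (t * u) x"
  have "?f t = 0"
  proof (rule additive_real_eq_0[of ?f])
    show "Modules.additive ?f"
      by unfold_locales (simp add: distrib_right additive.add[OF additive_scale_left])
    have "continuous_on UNIV (\<lambda>t. scale (t * u) x)"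
      by (rule continuous_on_compose2[OF continuous_scale_left]) (auto intro!: continuous_intros)
    then show "continuous_on UNIV ?f"
      by (intro continuous_on_diff continuous_scale_left)
  qed (simp add: scale_one)
  then show ?thesis by simp
qed

sublocale X: topological_vector_space scale
proof
  show "scale a (x + y) = scale a x + scale a y" for a x y
    by (rule additive.add[OF additive_scale_right])
  show "scale (a + b) x = scale a x + scale b x" for a b x
    by (rule additive.add[OF additive_scale_left])
  show "continuous_on UNIV (\<lambda>(r, x). scale r x)"
    unfolding continuous_on_def
  proof (intro ballI)
    fix w :: "real \<times> 'x"
    let ?F = "at w"
    obtain r x where w: "w = (r, x)" by fastforce
    have fst: "((\<lambda>v. fst v - r) \<longlongrightarrow> 0) ?F"
      using tendsto_fst[OF tendsto_ident_at[of w UNIV]] tendsto_iff_diff w by fastforce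
    have snd: "((\<lambda>v. snd v - x) \<longlongrightarrow> 0) ?F"
      using tendsto_snd[OF tendsto_ident_at[of w UNIV]] tendsto_iff_diff w by fastforce
    \<comment> \<open>a biadditive map is continuous as soon as it is so at zero jointly and in each variable separately\<close>
    have split: "scale (fst v) (snd v) - scale r x
        = scale (fst v - r) (snd v - x) + scale (fst v - r) x + scale r (snd v - x)" for v
      by (simp add: additive.diff[OF additive_scale_left] additive.diff[OF additive_scale_right])
    have "((\<lambda>v. scale (fst v - r) x) \<longlongrightarrow> scale 0 x) ?F"
      using continuous_on_tendsto_compose[OF continuous_scale_left fst] by simp
    moreover have "((\<lambda>v. scale r (snd v - x)) \<longlongrightarrow> scale r 0) ?F"
      using continuous_on_tendsto_compose[OF continuous_scale_right snd] by simp
    ultimately have "((\<lambda>v. scale (fst v) (snd v) - scale r x) \<longlongrightarrow> 0 + scale 0 x + scale r 0) ?F"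
      unfolding split by (intro tendsto_add scale_tendsto_0 fst snd)
    then have "((\<lambda>v. scale (fst v) (snd v) - scale r x) \<longlongrightarrow> 0) ?F"
      by (simp add: additive.zero[OF additive_scale_left] additive.zero[OF additive_scale_right])
    then show "((\<lambda>(r, x). scale r x) \<longlongrightarrow> (case w of (r, x) \<Rightarrow> scale r x)) ?F"
      unfolding w by (subst tendsto_iff_diff) (simp add: case_prod_beta)
  qed
qed (simp_all add: scale_scale scale_one)

sublocale tvs_extension "(*\<^sub>R)" scale "(*\<^sub>R)" i p
  by unfold_locales (simp_all add: i_hom p_hom scale_i p_scale)

end

section \<open>Extensions of metrizable spaces by Frechet spaces\<close>

theorem theorem24:
  fixes i :: "'y::{real_vector, topological_ab_group_add, t2_space}
                \<Rightarrow> 'x::{topological_ab_group_add, t2_space}"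
    and p :: "'x \<Rightarrow> 'z::{real_vector, topological_ab_group_add, t2_space}"
  assumes "group_extension i p"
    and "frechet_space TYPE('y)"
    and "topological_vector_space ((*\<^sub>R) :: real \<Rightarrow> 'z \<Rightarrow> 'z)"
    and "metrizable_space (euclidean :: 'z topology)"
  shows "\<exists>scale :: real \<Rightarrow> 'x \<Rightarrow> 'x.
           tvs_extension (*\<^sub>R) scale (*\<^sub>R) i p \<and>
           metrizable_space (euclidean :: 'x topology)"
proof -
  interpret E: frechet_extension i p
    using assms by (intro frechet_extension.intro frechet_extension_axioms.intro)
  have "metrizable_space (euclidean :: 'y topology)"
    using assms(2) by (simp add: frechet_space_def)
  then have "metrizable_space (euclidean :: 'x topology)"
    using assms(4) by (rule E.metrizable_middle)
  with E.tvs_extension_axioms show ?thesis by blast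
qed

end
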